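(* Let $I$ be a directed set and let $\mathfrak{F}\equiv(X_i,\mathcal{B}_i,\mu_i,\pi_{ij})$ be a convergent diagram in $\mathfrak{M}$ indexed by $I$, with limit $(X_\infty,\mathcal{B}_\infty,\mu_\infty,\pi_i)$. Then for each $1\le p<\infty$ the cocone $(L^p(X_\infty,\mu_\infty),\pi_i^* )$ is the colimit of the codiagram $(L^p(X_i,\mu_i),\pi_{ij}^* )$ in $\mathfrak{Ban}$; that is, the functor $L^p$ sends limits of convergent diagrams indexed by a directed set to colimits: $L^p(\lim\mathfrak{F})=\operatorname{colim}L^p\mathfrak{F}$.
   Context: A directed set is a nonempty set $I$ with a reflexive and transitive relation $\le$ such that any two elements have a common upper bound. $\mathfrak{M}$ is the category of probability spaces and measure preserving measurable maps ($f:(X,\mu)\to(Y,\nu)$ with $f_*\mu=\nu$, $f_*\mu(B)=\mu(f^{-1}(B))$). A diagram in $\mathfrak{M}$ indexed by $I$ is a family $(X_i,\mathcal{B}_i,\mu_i,\pi_{ij})$ of probability spaces $(X_i,\mathcal{B}_i,\mu_i)$, $i\in I$, and measure preserving maps $\pi_{ij}:X_j\to X_i$ for $i\le j$, with $\pi_{ii}=\mathrm{id}$ and $\pi_{ik}=\pi_{ij}\circ\pi_{jk}$ for $i\le j\le k$. Put $X_\infty=\{(x_i)_{i}\in\prod_{i\in I}X_i:\pi_{ij}(x_j)=x_i\text{ for all }i\le j\}$, let $\pi_j:X_\infty\to X_j$ be the coordinate projections, and $\mathcal{B}_\infty=\sigma(\{\pi_i^{-1}(B):B\in\mathcal{B}_i,\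 i\in I\})$. The diagram is convergent if there is a measure $\mu_\infty$ on $(X_\infty,\mathcal{B}_\infty)$ with $(\pi_i)_*\mu_\infty=\mu_i$ for every $i\in I$; then $(X_\infty,\mathcal{B}_\infty,\mu_\infty,\pi_i)$ is its limit in $\mathfrak{M}$. $L^p$ denotes spaces of real-valued functions. $\mathfrak{Ban}$ is the category of Banach spaces with linear isometries (not necessarily surjective) as morphisms. For a measure preserving map $f:(X,\mu)\to(Y,\nu)$, $f^*:L^p(Y,\nu)\to L^p(X,\mu)$, $f^*(u)=u\circ f$, is a linear isometry; this defines a contravariant functor $L^p:\mathfrak{M}\to\mathfrak{Ban}$. A codiagram in $\mathfrak{Ban}$ indexed by $I$ is a family $(Z_i,\varphi_{ij})$ of Banach spaces and linear isometries $\varphi_{ij}:Z_i\to Z_j$ ($i\le j$) with $\varphi_{ii}=\mathrm{id}$, $\varphi_{ik}=\varphi_{jk}\circ\varphi_{ij}$ for $i\le j\le k$. A cocone is a pair $(Y,\psi_i)$ of a Banach space and linear isometries $\psi_i:Z_i\to Y$ with $\psi_i=\psi_j\circ\varphi_{ij}$ for $i\le j$. It is a (realization of the) colimit if for every cocone $(Y',\rho_i)$ there is a unique linear isometry $\varphi:Y\to Y'$ with $\varphi\circ\psi_i=\rho_i$ for all $i\in I$. *)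

theory Defs
  imports "HOL-Probability.Probability" "HOL-Algebra.Module" "HOL-Algebra.Algebraic_Closure_Type"
begin

section \<open>Directed index sets and diagrams of probability spaces\<close>

locale directed_set =
  fixes I :: "'i set" and leq :: "'i \<Rightarrow> 'i \<Rightarrow> bool"
  assumes nonempty: "I \<noteq> {}"
    and leq_refl: "reflp_on I leq"
    and leq_trans: "transp_on I leq"
    and upper_bound: "\<And>i j. i \<in> I \<Longrightarrow> j \<in> I \<Longrightarrow> \<exists>k\<in>I. leq i k \<and> leq j k"

definition measure_preserving :: "'a measure \<Rightarrow> 'b measure \<Rightarrow> ('a \<Rightarrow> 'b) \<Rightarrow> bool" where
  "measure_preserving M N f \<longleftrightarrow> f \<in> measurable M N \<and> distr M N f = N"

text \<open>The spaces \<open>X\<^sub>i\<close> are subsets \<open>space (M i)\<close> of a common type;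
  maps are compared on these sets only.\<close>

locale prob_diagram =
  fixes I :: "'i set" and leq :: "'i \<Rightarrow> 'i \<Rightarrow> bool"
    and M :: "'i \<Rightarrow> 'a measure" and \<pi> :: "'i \<Rightarrow> 'i \<Rightarrow> 'a \<Rightarrow> 'a"
  assumes prob: "\<And>i. i \<in> I \<Longrightarrow> prob_space (M i)"
    and preserving: "\<And>i j. i \<in> I \<Longrightarrow> j \<in> I \<Longrightarrow> leq i j \<Longrightarrow> measure_preserving (M j) (M i) (\<pi> i j)"
    and ident: "\<And>i x. i \<in> I \<Longrightarrow> x \<in> space (M i) \<Longrightarrow> \<pi> i i x = x"
    and compose: "\<And>i j k x. i \<in> I \<Longrightarrow> j \<in> I \<Longrightarrow> k \<in> I \<Longrightarrow> leq i j \<Longrightarrow> leq j k \<Longrightarrow>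
      x \<in> space (M k) \<Longrightarrow> \<pi> i k x = \<pi> i j (\<pi> j k x)"

definition limit_space ::
    "'i set \<Rightarrow> ('i \<Rightarrow> 'i \<Rightarrow> bool) \<Rightarrow> ('i \<Rightarrow> 'a measure) \<Rightarrow> ('i \<Rightarrow> 'i \<Rightarrow> 'a \<Rightarrow> 'a) \<Rightarrow> ('i \<Rightarrow> 'a) set" where
  "limit_space I leq M \<pi> =
    {x \<in> \<Pi>\<^sub>E i\<in>I. space (M i). \<forall>i\<in>I. \<forall>j\<in>I. leq i j \<longrightarrow> \<pi> i j (x j) = x i}"

definition limit_sets ::
    "'i set \<Rightarrow> ('i \<Rightarrow> 'i \<Rightarrow> bool) \<Rightarrow> ('i \<Rightarrow> 'a measure) \<Rightarrow> ('i \<Rightarrow> 'i \<Rightarrow> 'a \<Rightarrow> 'a) \<Rightarrow> ('i \<Rightarrow> 'a) set set" where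
  "limit_sets I leq M \<pi> = sigma_sets (limit_space I leq M \<pi>)
    {(\<lambda>x. x i) -` B \<inter> limit_space I leq M \<pi> | i B. i \<in> I \<and> B \<in> sets (M i)}"

text \<open>A diagram is convergent iff some measure \<open>N\<close> satisfies the following predicate.\<close>

definition is_diagram_limit ::
    "'i set \<Rightarrow> ('i \<Rightarrow> 'i \<Rightarrow> bool) \<Rightarrow> ('i \<Rightarrow> 'a measure) \<Rightarrow> ('i \<Rightarrow> 'i \<Rightarrow> 'a \<Rightarrow> 'a) \<Rightarrow> ('i \<Rightarrow> 'a) measure \<Rightarrow> bool" where
  "is_diagram_limit I leq M \<pi> N \<longleftrightarrow>
    space N = limit_space I leq M \<pi> \<and> sets N = limit_sets I leq M \<pi> \<and>
    (\<forall>i\<in>I. distr N (M i) (\<lambda>x. x i) = M i)"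


section \<open>Banach spaces with explicit carriers\<close>

text \<open>The record type of modules also has the fields \<open>mult\<close> and \<open>one\<close>; they play no role here.\<close>

record 'b normed_space = "(real, 'b) module" +
  nrm :: "'b \<Rightarrow> real"

locale banach_space =
  fixes V :: "'b normed_space" (structure)
  assumes module: "module (ring_of_type_algebra :: real ring) V"
    and nrm_nonneg: "\<And>x. x \<in> carrier V \<Longrightarrow> 0 \<le> nrm V x"
    and nrm_eq_0: "\<And>x. x \<in> carrier V \<Longrightarrow> nrm V x = 0 \<longleftrightarrow> x = \<zero>"
    and nrm_smult: "\<And>c x. x \<in> carrier V \<Longrightarrow> nrm V (c \<odot> x) = \<bar>c\<bar> * nrm V x"
    and nrm_triangle: "\<And>x y. x \<in> carrier V \<Longrightarrow> y \<in> carrier V \<Longrightarrow> nrm V (x \<oplus> y) \<le> nrm V x + nrm V y"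
    and complete: "Metric_space.mcomplete (carrier V)
      (\<lambda>x y. if x \<in> carrier V \<and> y \<in> carrier V then nrm V (x \<ominus> y) else 0)"
  \<comment> \<open>\<open>Metric_space\<close> requires a distance that is nonnegative and symmetric also off the carrier.\<close>

definition linear_isometry :: "'b normed_space \<Rightarrow> 'c normed_space \<Rightarrow> ('b \<Rightarrow> 'c) \<Rightarrow> bool" where
  "linear_isometry V W f \<longleftrightarrow>
    f \<in> carrier V \<rightarrow> carrier W \<and>
    (\<forall>x\<in>carrier V. \<forall>y\<in>carrier V. f (x \<oplus>\<^bsub>V\<^esub> y) = f x \<oplus>\<^bsub>W\<^esub> f y) \<and>
    (\<forall>c. \<forall>x\<in>carrier V. f (c \<odot>\<^bsub>V\<^esub> x) = c \<odot>\<^bsub>W\<^esub> f x) \<and>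
    (\<forall>x\<in>carrier V. nrm W (f x) = nrm V x)"

locale banach_codiagram =
  fixes I :: "'i set" and leq :: "'i \<Rightarrow> 'i \<Rightarrow> bool"
    and Z :: "'i \<Rightarrow> 'b normed_space" and \<phi> :: "'i \<Rightarrow> 'i \<Rightarrow> 'b \<Rightarrow> 'b"
  assumes banach: "\<And>i. i \<in> I \<Longrightarrow> banach_space (Z i)"
    and isometry: "\<And>i j. i \<in> I \<Longrightarrow> j \<in> I \<Longrightarrow> leq i j \<Longrightarrow> linear_isometry (Z i) (Z j) (\<phi> i j)"
    and ident: "\<And>i z. i \<in> I \<Longrightarrow> z \<in> carrier (Z i) \<Longrightarrow> \<phi> i i z = z"
    and compose: "\<And>i j k z. i \<in> I \<Longrightarrow> j \<in> I \<Longrightarrow> k \<in> I \<Longrightarrow> leq i j \<Longrightarrow> leq j k \<Longrightarrow>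
      z \<in> carrier (Z i) \<Longrightarrow> \<phi> i k z = \<phi> j k (\<phi> i j z)"

locale banach_cocone = banach_codiagram I leq Z \<phi>
  for I :: "'i set" and leq :: "'i \<Rightarrow> 'i \<Rightarrow> bool"
    and Z :: "'i \<Rightarrow> 'b normed_space" and \<phi> :: "'i \<Rightarrow> 'i \<Rightarrow> 'b \<Rightarrow> 'b" +
  fixes Y :: "'c normed_space" and \<psi> :: "'i \<Rightarrow> 'b \<Rightarrow> 'c"
  assumes banach_apex: "banach_space Y"
    and isometry_leg: "\<And>i. i \<in> I \<Longrightarrow> linear_isometry (Z i) Y (\<psi> i)"
    and commutes: "\<And>i j z. i \<in> I \<Longrightarrow> j \<in> I \<Longrightarrow> leq i j \<Longrightarrow> z \<in> carrier (Z i) \<Longrightarrow> \<psi> i z = \<psi> j (\<phi> i j z)"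

text \<open>The type argument is the type carrying the competing cocones \<open>Y'\<close>; a statement about a free
  type variable \<open>'d\<close> covers all Banach spaces. Restricting to extensional maps makes
  uniqueness of the comparison map mean uniqueness on the carrier of \<open>Y\<close>.\<close>

definition is_banach_colimit ::
    "'d itself \<Rightarrow> 'i set \<Rightarrow> ('i \<Rightarrow> 'i \<Rightarrow> bool) \<Rightarrow> ('i \<Rightarrow> 'b normed_space) \<Rightarrow> ('i \<Rightarrow> 'i \<Rightarrow> 'b \<Rightarrow> 'b) \<Rightarrow>
     'c normed_space \<Rightarrow> ('i \<Rightarrow> 'b \<Rightarrow> 'c) \<Rightarrow> bool" where
  "is_banach_colimit (T :: 'd itself) I leq Z \<phi> Y \<psi> \<longleftrightarrow>
    banach_cocone I leq Z \<phi> Y \<psi> \<and>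
    (\<forall>(Y' :: 'd normed_space) \<rho>. banach_cocone I leq Z \<phi> Y' \<rho> \<longrightarrow>
      (\<exists>!f. f \<in> extensional (carrier Y) \<and> linear_isometry Y Y' f \<and>
        (\<forall>i\<in>I. \<forall>z\<in>carrier (Z i). f (\<psi> i z) = \<rho> i z)))"


section \<open>The functor \<open>L\<^sup>p\<close>\<close>

definition Lp_fun :: "real \<Rightarrow> 'a measure \<Rightarrow> ('a \<Rightarrow> real) set" where
  "Lp_fun p M = {u \<in> borel_measurable M. integrable M (\<lambda>x. \<bar>u x\<bar> powr p)}"

definition Lp_rel :: "real \<Rightarrow> 'a measure \<Rightarrow> (('a \<Rightarrow> real) \<times> ('a \<Rightarrow> real)) set" where
  "Lp_rel p M = {(u, v). u \<in> Lp_fun p M \<and> v \<in> Lp_fun p M \<and> (AE x in M. u x = v x)}"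

definition Lp :: "real \<Rightarrow> 'a measure \<Rightarrow> ('a \<Rightarrow> real) set normed_space" where
  "Lp p M = \<lparr>
    carrier = Lp_fun p M // Lp_rel p M,
    monoid.mult = undefined,
    one = undefined,
    ring.zero = Lp_rel p M `` {\<lambda>_. 0},
    add = (\<lambda>U V. \<Union>u\<in>U. \<Union>v\<in>V. Lp_rel p M `` {\<lambda>x. u x + v x}),
    smult = (\<lambda>c U. \<Union>u\<in>U. Lp_rel p M `` {\<lambda>x. c * u x}),
    nrm = (\<lambda>U. the_elem ((\<lambda>u. (LINT x|M. \<bar>u x\<bar> powr p) powr (1 / p)) ` U)) \<rparr>"

text \<open>The map \<open>f\<^sup>*\<close> induced by a measure preserving \<open>f\<close> with domain \<open>M\<close>.\<close>

definition Lp_pullback :: "real \<Rightarrow> 'a measure \<Rightarrow> ('a \<Rightarrow> 'b) \<Rightarrow> ('b \<Rightarrow> real) set \<Rightarrow> ('a \<Rightarrow> real) set" where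
  "Lp_pullback p M f U = (\<Union>u\<in>U. Lp_rel p M `` {u \<circ> f})"

end

theory Submission
  imports Defs
begin

text \<open>Two facts make the theorem true.

  A cocone of Banach spaces over a directed codiagram is a colimit as soon as the union of the images
  of its legs is dense (\<open>colimit_if_dense_images\<close>).  By directedness any two elements of the codiagram
  live at a common index, where the legs of every cocone are isometric; so the legs of a competing
  cocone \<open>W\<close> factor through an isometry defined on the union of the images in \<open>Y\<close>, and this
  extends uniquely to the closure because \<open>W\<close> is complete.  The proof describes the extension by
  its graph, the closure of the set of pairs of corresponding leg values.

  In the limit of the diagram of probability spaces, the functions depending on a single coordinate are
  dense in \<open>L\<^sup>p\<close> (\<open>approximable_Lp\<close>).  The cylinder sets over single coordinates generate the
  \<open>\<sigma>\<close>-algebra and, again by directedness, are closed under intersection.  Dynkin's theorem therefore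
  carries approximability from cylinder sets to the indicators of all measurable sets
  (\<open>approximable_indicator\<close>), and simple functions together with dominated convergence carry it to
  all of \<open>L\<^sup>p\<close>; this is the point where \<open>p < \<infinity>\<close> matters.

  Between these two parts stands the classical theory of \<open>L\<^sup>p\<close> on finite measure spaces: Minkowski's
  inequality (\<open>Lp_norm_triangle\<close>), the Riesz--Fischer theorem (\<open>Lp_fun_complete\<close>), and the passage to
  the quotient by almost everywhere equality, under which measure preserving maps induce linear
  isometries (\<open>linear_isometry_Lp_pullback\<close>).\<close>


section \<open>Norm estimates and sequential completeness\<close>

text \<open>The axioms of \<open>banach_space\<close> up to completeness.  Keeping them apart allows completeness to
  be restated through Cauchy sequences, using norm estimates that need no completeness.\<close>

locale normed_module =
  fixes V :: "'b normed_space" (structure)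
  assumes module: "module (ring_of_type_algebra :: real ring) V"
    and nrm_nonneg: "\<And>x. x \<in> carrier V \<Longrightarrow> 0 \<le> nrm V x"
    and nrm_eq_0: "\<And>x. x \<in> carrier V \<Longrightarrow> nrm V x = 0 \<longleftrightarrow> x = \<zero>"
    and nrm_smult: "\<And>c x. x \<in> carrier V \<Longrightarrow> nrm V (c \<odot> x) = \<bar>c\<bar> * nrm V x"
    and nrm_triangle: "\<And>x y. x \<in> carrier V \<Longrightarrow> y \<in> carrier V \<Longrightarrow> nrm V (x \<oplus> y) \<le> nrm V x + nrm V y"

sublocale banach_space \<subseteq> normed_module
  by (rule normed_module.intro) (fact module nrm_nonneg nrm_eq_0 nrm_smult nrm_triangle)+

sublocale normed_module \<subseteq> module "ring_of_type_algebra :: real ring" V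
  by (rule module)

lemma carrier_reals [simp]: "carrier (ring_of_type_algebra :: real ring) = UNIV"
  and one_reals: "\<one>\<^bsub>(ring_of_type_algebra :: real ring)\<^esub> = 1"
  and zero_reals: "\<zero>\<^bsub>(ring_of_type_algebra :: real ring)\<^esub> = 0"
  and add_reals: "x \<oplus>\<^bsub>(ring_of_type_algebra :: real ring)\<^esub> y = x + y"
  and mult_reals: "x \<otimes>\<^bsub>(ring_of_type_algebra :: real ring)\<^esub> y = x * y"
  by (simp_all add: ring_of_type_algebra_def)

lemma uminus_reals: "\<ominus>\<^bsub>(ring_of_type_algebra :: real ring)\<^esub> x = - x"
proof -
  interpret R: cring "ring_of_type_algebra :: real ring"
    by (rule cring_from_type_algebra)
  show ?thesis
    by (rule R.minus_equality) (simp_all add: add_reals zero_reals)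
qed

context normed_module
begin

lemma smult_minus_one: "x \<in> carrier V \<Longrightarrow> (- 1) \<odot> x = \<ominus> x"
  using smult_l_minus[of 1 x] smult_one[of x] by (simp add: uminus_reals one_reals)

lemma nrm_diff_swap: "x \<in> carrier V \<Longrightarrow> y \<in> carrier V \<Longrightarrow> nrm V (x \<ominus> y) = nrm V (y \<ominus> x)"
  using nrm_smult[of "y \<ominus> x" "- 1"]
  by (simp add: smult_minus_one a_minus_def M.minus_add M.add.m_comm)

lemma nrm_diff_triangle:
  assumes "x \<in> carrier V" "y \<in> carrier V" "z \<in> carrier V"
  shows "nrm V (x \<ominus> z) \<le> nrm V (x \<ominus> y) + nrm V (y \<ominus> z)"
proof -
  have "x \<ominus> z = (x \<ominus> y) \<oplus> (y \<ominus> z)"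
    using assms by (simp add: a_minus_def M.a_assoc M.r_neg1)
  then show ?thesis
    using assms nrm_triangle[of "x \<ominus> y" "y \<ominus> z"] by simp
qed

lemma nrm_diff_eq_0: 
  "x \<in> carrier V \<Longrightarrow> y \<in> carrier V \<Longrightarrow> nrm V (x \<ominus> y) = 0 \<longleftrightarrow> x = y"
  using M.minus_equality[of x "\<ominus> y"] by (auto simp: nrm_eq_0 a_minus_def M.r_neg)

lemma nrm_le_nrm_add_diff:
  assumes "x \<in> carrier V" "y \<in> carrier V"
  shows "nrm V x \<le> nrm V y + nrm V (x \<ominus> y)"
  using assms nrm_triangle[of y "x \<ominus> y"]
  by (simp add: a_minus_def M.a_lcomm[of y] M.r_neg)

lemma nrm_add_diff_add_le:
  assumes "a \<in> carrier V" "b \<in> carrier V" "c \<in> carrier V" "d \<in> carrier V"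
  shows "nrm V ((a \<oplus> b) \<ominus> (c \<oplus> d)) \<le> nrm V (a \<ominus> c) + nrm V (b \<ominus> d)"
proof -
  have "(a \<oplus> b) \<ominus> (c \<oplus> d) = (a \<ominus> c) \<oplus> (b \<ominus> d)"
    using assms by (simp add: a_minus_def M.minus_add M.a_ac)
  then show ?thesis
    using assms nrm_triangle[of "a \<ominus> c" "b \<ominus> d"] by simp
qed

lemma nrm_smult_diff_smult:
  assumes "x \<in> carrier V" "y \<in> carrier V"
  shows "nrm V (c \<odot> x \<ominus> c \<odot> y) = \<bar>c\<bar> * nrm V (x \<ominus> y)"
  using assms nrm_smult[of "x \<ominus> y" c] smult_r_distr[of c x "\<ominus> y"] smult_r_minus[of c y]
  by (simp add: a_minus_def)

lemma Metric_space_nrm: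
  "Metric_space (carrier V)
    (\<lambda>x y. if x \<in> carrier V \<and> y \<in> carrier V then nrm V (x \<ominus> y) else 0)"
  by (rule Metric_space.intro) 
    (auto simp: nrm_nonneg nrm_diff_swap nrm_diff_eq_0 intro: nrm_diff_triangle)

lemma banach_space_iff_Cauchy_convergent:
  "banach_space V \<longleftrightarrow>
    (\<forall>s. (\<forall>n::nat. s n \<in> carrier V) \<and> (\<forall>e>0. \<exists>K. \<forall>m\<ge>K. \<forall>n\<ge>K. nrm V (s m \<ominus> s n) < e) \<longrightarrow>
      (\<exists>w\<in>carrier V. \<forall>e>0. \<exists>K. \<forall>n\<ge>K. nrm V (s n \<ominus> w) < e))"
  (is "_ \<longleftrightarrow> ?complete")
proof -
  interpret Metric_space "carrier V"
    "\<lambda>x y. if x \<in> carrier V \<and> y \<in> carrier V then nrm V (x \<ominus> y) else 0"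
    by (rule Metric_space_nrm)
  have "banach_space V \<longleftrightarrow> mcomplete"
    using module nrm_nonneg nrm_eq_0 nrm_smult nrm_triangle unfolding banach_space_def by blast
  also have "\<dots> \<longleftrightarrow> ?complete"
  proof -
    have "MCauchy s \<longleftrightarrow> (\<forall>n. s n \<in> carrier V) \<and>
        (\<forall>e>0. \<exists>K. \<forall>m\<ge>K. \<forall>n\<ge>K. nrm V (s m \<ominus> s n) < e)" for s
      unfolding MCauchy_def image_subset_iff by (auto cong: conj_cong)
    moreover have "limitin mtopology s w sequentially \<longleftrightarrow>
        w \<in> carrier V \<and> (\<forall>e>0. \<exists>K. \<forall>n\<ge>K. nrm V (s n \<ominus> w) < e)"
      if "\<forall>n. s n \<in> carrier V" for s w
      using that unfolding limit_metric_sequentially by (auto cong: conj_cong)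
    ultimately show ?thesis
      unfolding mcomplete_def by (simp add: Bex_def)
  qed
  finally show ?thesis .
qed

end

lemma (in banach_space) Cauchy_convergent:
  assumes "\<And>n::nat. s n \<in> carrier V"
    and "\<And>e. e > 0 \<Longrightarrow> \<exists>K. \<forall>m\<ge>K. \<forall>n\<ge>K. nrm V (s m \<ominus> s n) < e"
  obtains w where "w \<in> carrier V" "\<And>e. e > 0 \<Longrightarrow> \<exists>K. \<forall>n\<ge>K. nrm V (s n \<ominus> w) < e"
proof -
  have "\<exists>w\<in>carrier V. \<forall>e>0. \<exists>K. \<forall>n\<ge>K. nrm V (s n \<ominus> w) < e"
    using banach_space_axioms[unfolded banach_space_iff_Cauchy_convergent, rule_format, of s] assms
    by simp
  then show ?thesis
    using that by auto
qed

lemma linear_isometry_diff: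
  assumes "normed_module V" "normed_module W" "linear_isometry V W f"
    and x: "x \<in> carrier V" "y \<in> carrier V"
  shows "f (x \<ominus>\<^bsub>V\<^esub> y) = f x \<ominus>\<^bsub>W\<^esub> f y"
proof -
  interpret V: normed_module V by fact
  interpret W: normed_module W by fact
  have f: "f u \<in> carrier W" "f (u \<oplus>\<^bsub>V\<^esub> v) = f u \<oplus>\<^bsub>W\<^esub> f v" "f (c \<odot>\<^bsub>V\<^esub> u) = c \<odot>\<^bsub>W\<^esub> f u"
    if "u \<in> carrier V" "v \<in> carrier V" for u v c
    using assms(3) that unfolding linear_isometry_def by auto
  have "f (\<ominus>\<^bsub>V\<^esub> y) = \<ominus>\<^bsub>W\<^esub> f y"
    using f(3)[of y y "- 1"] x f(1)[of y y] by (simp add: V.smult_minus_one W.smult_minus_one)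
  then show ?thesis
    using x f(2)[of x "\<ominus>\<^bsub>V\<^esub> y"] by (simp add: a_minus_def)
qed

lemma linear_isometry_dist:
  assumes "normed_module V" "normed_module W" "linear_isometry V W f"
    and "x \<in> carrier V" "y \<in> carrier V"
  shows "nrm W (f x \<ominus>\<^bsub>W\<^esub> f y) = nrm V (x \<ominus>\<^bsub>V\<^esub> y)"
proof -
  interpret V: normed_module V by fact
  have "nrm W (f (x \<ominus>\<^bsub>V\<^esub> y)) = nrm V (x \<ominus>\<^bsub>V\<^esub> y)"
    using assms unfolding linear_isometry_def by simp
  then show ?thesis
    using linear_isometry_diff[OF assms] by simp
qed


section \<open>Cocones with dense images are colimits\<close>

text \<open>The cocone \<open>W\<close> is the one that competes with \<open>Y\<close>; until density is assumed, their roles are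
  symmetric.\<close>

locale two_cocones = directed_set I leq + Y: banach_cocone I leq Z \<phi> Y \<psi> +
    W: banach_cocone I leq Z \<phi> W \<rho>
  for I :: "'i set" and leq :: "'i \<Rightarrow> 'i \<Rightarrow> bool"
    and Z :: "'i \<Rightarrow> 'b normed_space" and \<phi> :: "'i \<Rightarrow> 'i \<Rightarrow> 'b \<Rightarrow> 'b"
    and Y :: "'c normed_space" and \<psi> :: "'i \<Rightarrow> 'b \<Rightarrow> 'c"
    and W :: "'d normed_space" and \<rho> :: "'i \<Rightarrow> 'b \<Rightarrow> 'd"
begin

sublocale Y: banach_space Y by (rule Y.banach_apex)
sublocale W: banach_space W by (rule W.banach_apex)

lemma normed_Z: "i \<in> I \<Longrightarrow> normed_module (Z i)"
  using Y.banach[of i] by (simp add: banach_space_def normed_module_def)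

lemma \<psi>_closed: "i \<in> I \<Longrightarrow> z \<in> carrier (Z i) \<Longrightarrow> \<psi> i z \<in> carrier Y"
  and \<rho>_closed: "i \<in> I \<Longrightarrow> z \<in> carrier (Z i) \<Longrightarrow> \<rho> i z \<in> carrier W"
  using Y.isometry_leg[of i] W.isometry_leg[of i] by (auto simp: linear_isometry_def)

text \<open>Any two elements of the codiagram can be moved to a common index, and both legs there are
  isometric.  So the two cocones induce the same distance between elements at different indices.\<close>

lemma common_index:
  assumes i: "i \<in> I" "z \<in> carrier (Z i)" and j: "j \<in> I" "z' \<in> carrier (Z j)"
  obtains k a b where "k \<in> I" "a \<in> carrier (Z k)" "b \<in> carrier (Z k)"
    "\<psi> i z = \<psi> k a" "\<psi> j z' = \<psi> k b" "\<rho> i z = \<rho> k a" "\<rho> j z' = \<rho> k b"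
proof -
  obtain k where k: "k \<in> I" "leq i k" "leq j k"
    using upper_bound i j by blast
  show ?thesis
  proof
    show "\<phi> i k z \<in> carrier (Z k)" "\<phi> j k z' \<in> carrier (Z k)"
      using Y.isometry[of i k] Y.isometry[of j k] i j k unfolding linear_isometry_def by auto
  qed (use i j k Y.commutes W.commutes in auto)
qed

lemma leg_dist_eq:
  assumes i: "i \<in> I" "z \<in> carrier (Z i)" and j: "j \<in> I" "z' \<in> carrier (Z j)"
  shows "nrm Y (\<psi> i z \<ominus>\<^bsub>Y\<^esub> \<psi> j z') = nrm W (\<rho> i z \<ominus>\<^bsub>W\<^esub> \<rho> j z')"
  using i j
proof (rule common_index)
  fix k a b
  assume k: "k \<in> I" "a \<in> carrier (Z k)" "b \<in> carrier (Z k)"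
    and eq: "\<psi> i z = \<psi> k a" "\<psi> j z' = \<psi> k b" "\<rho> i z = \<rho> k a" "\<rho> j z' = \<rho> k b"
  have "nrm Y (\<psi> k a \<ominus>\<^bsub>Y\<^esub> \<psi> k b) = nrm (Z k) (a \<ominus>\<^bsub>Z k\<^esub> b)"
    using k by (intro linear_isometry_dist normed_Z Y.normed_module_axioms Y.isometry_leg)
  moreover have "nrm W (\<rho> k a \<ominus>\<^bsub>W\<^esub> \<rho> k b) = nrm (Z k) (a \<ominus>\<^bsub>Z k\<^esub> b)"
    using k by (intro linear_isometry_dist normed_Z W.normed_module_axioms W.isometry_leg)
  ultimately show ?thesis
    by (simp add: eq)
qed

text \<open>The closure in \<open>Y \<times> W\<close> of the pairs \<open>(\<psi>\<^sub>i z, \<rho>\<^sub>i z)\<close>.  It turns out to be the graph of the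
  comparison map.\<close>

definition corresponds :: "'c \<Rightarrow> 'd \<Rightarrow> bool" where
  "corresponds y w \<longleftrightarrow> y \<in> carrier Y \<and> w \<in> carrier W \<and>
    (\<forall>e>0. \<exists>i\<in>I. \<exists>z\<in>carrier (Z i). nrm Y (y \<ominus>\<^bsub>Y\<^esub> \<psi> i z) < e \<and> nrm W (w \<ominus>\<^bsub>W\<^esub> \<rho> i z) < e)"

lemma correspondsE:
  assumes "corresponds y w" "e > 0"
  obtains i z where "i \<in> I" "z \<in> carrier (Z i)"
    "nrm Y (y \<ominus>\<^bsub>Y\<^esub> \<psi> i z) < e" "nrm W (w \<ominus>\<^bsub>W\<^esub> \<rho> i z) < e"
  using assms unfolding corresponds_def by blast

lemma corresponds_legs:
  assumes "i \<in> I" "z \<in> carrier (Z i)"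
  shows "corresponds (\<psi> i z) (\<rho> i z)"
proof -
  have "nrm Y (\<psi> i z \<ominus>\<^bsub>Y\<^esub> \<psi> i z) = 0" "nrm W (\<rho> i z \<ominus>\<^bsub>W\<^esub> \<rho> i z) = 0"
    using assms by (simp_all add: Y.nrm_diff_eq_0 W.nrm_diff_eq_0 \<psi>_closed \<rho>_closed)
  then show ?thesis
    using assms by (auto simp: corresponds_def \<psi>_closed \<rho>_closed intro!: bexI[of _ i] bexI[of _ z])
qed

lemma corresponds_add:
  assumes "corresponds y w" "corresponds y' w'"
  shows "corresponds (y \<oplus>\<^bsub>Y\<^esub> y') (w \<oplus>\<^bsub>W\<^esub> w')"
  unfolding corresponds_def
proof (intro conjI allI impI)
  have yw: "y \<in> carrier Y" "w \<in> carrier W" "y' \<in> carrier Y" "w' \<in> carrier W"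
    using assms unfolding corresponds_def by auto
  then show "y \<oplus>\<^bsub>Y\<^esub> y' \<in> carrier Y" "w \<oplus>\<^bsub>W\<^esub> w' \<in> carrier W"
    by auto
  fix e :: real
  assume "e > 0"
  then have e2: "e / 2 > 0" by simp
  obtain i z where i: "i \<in> I" "z \<in> carrier (Z i)"
    and z: "nrm Y (y \<ominus>\<^bsub>Y\<^esub> \<psi> i z) < e / 2" "nrm W (w \<ominus>\<^bsub>W\<^esub> \<rho> i z) < e / 2"
    using correspondsE[OF assms(1) e2] .
  obtain j z' where j: "j \<in> I" "z' \<in> carrier (Z j)"
    and z': "nrm Y (y' \<ominus>\<^bsub>Y\<^esub> \<psi> j z') < e / 2" "nrm W (w' \<ominus>\<^bsub>W\<^esub> \<rho> j z') < e / 2"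
    using correspondsE[OF assms(2) e2] .
  obtain k a b where k: "k \<in> I" "a \<in> carrier (Z k)" "b \<in> carrier (Z k)"
    and eq: "\<psi> i z = \<psi> k a" "\<psi> j z' = \<psi> k b" "\<rho> i z = \<rho> k a" "\<rho> j z' = \<rho> k b"
    using common_index[OF i j] .
  interpret Zk: normed_module "Z k" by (rule normed_Z) fact
  have sum: "\<psi> k (a \<oplus>\<^bsub>Z k\<^esub> b) = \<psi> k a \<oplus>\<^bsub>Y\<^esub> \<psi> k b" "\<rho> k (a \<oplus>\<^bsub>Z k\<^esub> b) = \<rho> k a \<oplus>\<^bsub>W\<^esub> \<rho> k b"
    using Y.isometry_leg W.isometry_leg k unfolding linear_isometry_def by auto
  have "nrm Y ((y \<oplus>\<^bsub>Y\<^esub> y') \<ominus>\<^bsub>Y\<^esub> \<psi> k (a \<oplus>\<^bsub>Z k\<^esub> b)) < e"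
    using Y.nrm_add_diff_add_le[of y y' "\<psi> k a" "\<psi> k b"] z z' yw k
    by (simp add: \<psi>_closed sum eq)
  moreover have "nrm W ((w \<oplus>\<^bsub>W\<^esub> w') \<ominus>\<^bsub>W\<^esub> \<rho> k (a \<oplus>\<^bsub>Z k\<^esub> b)) < e"
    using W.nrm_add_diff_add_le[of w w' "\<rho> k a" "\<rho> k b"] z z' yw k
    by (simp add: \<rho>_closed sum eq)
  ultimately show "\<exists>i\<in>I. \<exists>z\<in>carrier (Z i).
      nrm Y ((y \<oplus>\<^bsub>Y\<^esub> y') \<ominus>\<^bsub>Y\<^esub> \<psi> i z) < e \<and> nrm W ((w \<oplus>\<^bsub>W\<^esub> w') \<ominus>\<^bsub>W\<^esub> \<rho> i z) < e"
    using k Zk.M.a_closed by blast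
qed

lemma corresponds_smult:
  assumes "corresponds y w"
  shows "corresponds (c \<odot>\<^bsub>Y\<^esub> y) (c \<odot>\<^bsub>W\<^esub> w)"
  unfolding corresponds_def
proof (intro conjI allI impI)
  have yw: "y \<in> carrier Y" "w \<in> carrier W"
    using assms unfolding corresponds_def by auto
  then show "c \<odot>\<^bsub>Y\<^esub> y \<in> carrier Y" "c \<odot>\<^bsub>W\<^esub> w \<in> carrier W"
    by auto
  fix e :: real
  assume "e > 0"
  \<comment> \<open>adding 1 keeps the denominator positive when \<open>c = 0\<close>\<close>
  define d where "d = e / (\<bar>c\<bar> + 1)"
  have d: "d > 0" "\<bar>c\<bar> * d < e"
    using \<open>e > 0\<close> by (simp_all add: d_def field_simps)
  obtain i z where i: "i \<in> I" "z \<in> carrier (Z i)"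
    and z: "nrm Y (y \<ominus>\<^bsub>Y\<^esub> \<psi> i z) < d" "nrm W (w \<ominus>\<^bsub>W\<^esub> \<rho> i z) < d"
    using correspondsE[OF assms d(1)] .
  interpret Zi: normed_module "Z i" by (rule normed_Z) fact
  have scaled: "\<psi> i (c \<odot>\<^bsub>Z i\<^esub> z) = c \<odot>\<^bsub>Y\<^esub> \<psi> i z" "\<rho> i (c \<odot>\<^bsub>Z i\<^esub> z) = c \<odot>\<^bsub>W\<^esub> \<rho> i z"
    using Y.isometry_leg W.isometry_leg i unfolding linear_isometry_def by auto
  have "\<bar>c\<bar> * nrm Y (y \<ominus>\<^bsub>Y\<^esub> \<psi> i z) \<le> \<bar>c\<bar> * d" "\<bar>c\<bar> * nrm W (w \<ominus>\<^bsub>W\<^esub> \<rho> i z) \<le> \<bar>c\<bar> * d"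
    using z by (auto intro!: mult_left_mono)
  then have "nrm Y (c \<odot>\<^bsub>Y\<^esub> y \<ominus>\<^bsub>Y\<^esub> \<psi> i (c \<odot>\<^bsub>Z i\<^esub> z)) < e"
    "nrm W (c \<odot>\<^bsub>W\<^esub> w \<ominus>\<^bsub>W\<^esub> \<rho> i (c \<odot>\<^bsub>Z i\<^esub> z)) < e"
    using d(2) yw i by (simp_all add: scaled Y.nrm_smult_diff_smult W.nrm_smult_diff_smult \<psi>_closed \<rho>_closed)
  then show "\<exists>i\<in>I. \<exists>z\<in>carrier (Z i).
      nrm Y (c \<odot>\<^bsub>Y\<^esub> y \<ominus>\<^bsub>Y\<^esub> \<psi> i z) < e \<and> nrm W (c \<odot>\<^bsub>W\<^esub> w \<ominus>\<^bsub>W\<^esub> \<rho> i z) < e"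
    using i Zi.smult_closed[of c z] unfolding carrier_reals by blast
qed

text \<open>Distances in the two cocones agree on the legs by \<open>leg_dist_eq\<close>, and both sides of that
  equation are continuous.\<close>

lemma corresponds_dist_le:
  assumes "corresponds y w" "corresponds y' w'"
  shows "nrm W (w \<ominus>\<^bsub>W\<^esub> w') \<le> nrm Y (y \<ominus>\<^bsub>Y\<^esub> y')"
proof (rule field_le_epsilon)
  have yw: "y \<in> carrier Y" "w \<in> carrier W" "y' \<in> carrier Y" "w' \<in> carrier W"
    using assms unfolding corresponds_def by auto
  fix e :: real
  assume "e > 0"
  \<comment> \<open>four approximation errors occur below\<close>
  then have e4: "e / 4 > 0" by simp
  obtain i z where i: "i \<in> I" "z \<in> carrier (Z i)"
    and z: "nrm Y (y \<ominus>\<^bsub>Y\<^esub> \<psi> i z) < e / 4" "nrm W (w \<ominus>\<^bsub>W\<^esub> \<rho> i z) < e / 4"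
    using correspondsE[OF assms(1) e4] .
  obtain j z' where j: "j \<in> I" "z' \<in> carrier (Z j)"
    and z': "nrm Y (y' \<ominus>\<^bsub>Y\<^esub> \<psi> j z') < e / 4" "nrm W (w' \<ominus>\<^bsub>W\<^esub> \<rho> j z') < e / 4"
    using correspondsE[OF assms(2) e4] .
  note cl = yw \<psi>_closed[OF i] \<psi>_closed[OF j] \<rho>_closed[OF i] \<rho>_closed[OF j]
  have "nrm W (w \<ominus>\<^bsub>W\<^esub> w') \<le> nrm W (w \<ominus>\<^bsub>W\<^esub> \<rho> i z) + (nrm W (\<rho> i z \<ominus>\<^bsub>W\<^esub> \<rho> j z') + nrm W (w' \<ominus>\<^bsub>W\<^esub> \<rho> j z'))"
    using W.nrm_diff_triangle[of w "\<rho> i z" w'] W.nrm_diff_triangle[of "\<rho> i z" "\<rho> j z'" w']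
      W.nrm_diff_swap[of w' "\<rho> j z'"] cl by simp
  moreover have "nrm Y (\<psi> i z \<ominus>\<^bsub>Y\<^esub> \<psi> j z') \<le>
      nrm Y (y \<ominus>\<^bsub>Y\<^esub> \<psi> i z) + (nrm Y (y \<ominus>\<^bsub>Y\<^esub> y') + nrm Y (y' \<ominus>\<^bsub>Y\<^esub> \<psi> j z'))"
    using Y.nrm_diff_triangle[of "\<psi> i z" y "\<psi> j z'"] Y.nrm_diff_triangle[of y y' "\<psi> j z'"]
      Y.nrm_diff_swap[of y "\<psi> i z"] cl by simp
  ultimately show "nrm W (w \<ominus>\<^bsub>W\<^esub> w') \<le> nrm Y (y \<ominus>\<^bsub>Y\<^esub> y') + e"
    using leg_dist_eq[OF i j] z z' by simp
qed

lemma corresponds_unique: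
  assumes "corresponds y w" "corresponds y w'"
  shows "w = w'"
proof -
  have yw: "y \<in> carrier Y" "w \<in> carrier W" "w' \<in> carrier W"
    using assms unfolding corresponds_def by auto
  then have "nrm W (w \<ominus>\<^bsub>W\<^esub> w') \<le> 0"
    using corresponds_dist_le[OF assms] Y.nrm_diff_eq_0[of y y] by simp
  then show ?thesis
    using yw W.nrm_nonneg[of "w \<ominus>\<^bsub>W\<^esub> w'"] W.nrm_diff_eq_0[of w w'] by simp
qed

lemma corresponds_nrm_eq:
  assumes "corresponds y w"
  shows "nrm W w = nrm Y y"
proof -
  have yw: "y \<in> carrier Y" "w \<in> carrier W"
    using assms unfolding corresponds_def by auto
  have "\<bar>nrm W w - nrm Y y\<bar> \<le> 0 + e" if "e > 0" for e
  proof -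
    from that have "e / 2 > 0" by simp
    from correspondsE[OF assms this] obtain i z where i: "i \<in> I" "z \<in> carrier (Z i)"
      and z: "nrm Y (y \<ominus>\<^bsub>Y\<^esub> \<psi> i z) < e / 2" "nrm W (w \<ominus>\<^bsub>W\<^esub> \<rho> i z) < e / 2" .
    note cl = yw \<psi>_closed[OF i] \<rho>_closed[OF i]
    have "nrm Y (\<psi> i z) = nrm W (\<rho> i z)"
      using i Y.isometry_leg W.isometry_leg unfolding linear_isometry_def by simp
    then show ?thesis
      using z cl Y.nrm_le_nrm_add_diff[of y "\<psi> i z"] Y.nrm_le_nrm_add_diff[of "\<psi> i z" y]
        W.nrm_le_nrm_add_diff[of w "\<rho> i z"] W.nrm_le_nrm_add_diff[of "\<rho> i z" w]
        Y.nrm_diff_swap[of y "\<psi> i z"] W.nrm_diff_swap[of w "\<rho> i z"] by linarith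
  qed
  then have "\<bar>nrm W w - nrm Y y\<bar> \<le> 0"
    by (rule field_le_epsilon)
  then show ?thesis by simp
qed

text \<open>Approximating \<open>y\<close> by images under the legs of \<open>Y\<close> gives a Cauchy sequence, which the legs of
  \<open>W\<close> turn into a Cauchy sequence with the same mutual distances.  Its limit corresponds to \<open>y\<close>.\<close>

lemma corresponds_exists:
  assumes dense: "\<And>e. e > 0 \<Longrightarrow> \<exists>i\<in>I. \<exists>z\<in>carrier (Z i). nrm Y (y \<ominus>\<^bsub>Y\<^esub> \<psi> i z) < e"
    and y: "y \<in> carrier Y"
  shows "\<exists>w. corresponds y w"
proof -
  have "\<forall>n::nat. \<exists>i z. i \<in> I \<and> z \<in> carrier (Z i) \<and> nrm Y (y \<ominus>\<^bsub>Y\<^esub> \<psi> i z) < inverse (Suc n)"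
  proof
    fix n :: nat
    show "\<exists>i z. i \<in> I \<and> z \<in> carrier (Z i) \<and> nrm Y (y \<ominus>\<^bsub>Y\<^esub> \<psi> i z) < inverse (Suc n)"
      using dense[of "inverse (Suc n)"] by (simp add: Bex_def)
  qed
  then obtain i z where i: "\<And>n. i n \<in> I" "\<And>n. z n \<in> carrier (Z (i n))"
    and z: "\<And>n::nat. nrm Y (y \<ominus>\<^bsub>Y\<^esub> \<psi> (i n) (z n)) < inverse (Suc n)"
    by metis
  have small: "\<exists>K. \<forall>n\<ge>K. nrm Y (y \<ominus>\<^bsub>Y\<^esub> \<psi> (i n) (z n)) < e" if "e > 0" for e
  proof -
    obtain K where "inverse (Suc K) < e"
      using reals_Archimedean \<open>e > 0\<close> by blast
    moreover have "inverse (real (Suc n)) \<le> inverse (real (Suc K))" if "n \<ge> K" for n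
      using that by (intro le_imp_inverse_le) auto
    ultimately have "nrm Y (y \<ominus>\<^bsub>Y\<^esub> \<psi> (i n) (z n)) < e" if "n \<ge> K" for n
      using z[of n] that by (meson order_less_le_trans order_less_trans)
    then show ?thesis by blast
  qed
  have Cauchy: "\<exists>K. \<forall>m\<ge>K. \<forall>n\<ge>K. nrm W (\<rho> (i m) (z m) \<ominus>\<^bsub>W\<^esub> \<rho> (i n) (z n)) < e" if "e > 0" for e
  proof -
    obtain K where K: "\<And>n. n \<ge> K \<Longrightarrow> nrm Y (y \<ominus>\<^bsub>Y\<^esub> \<psi> (i n) (z n)) < e / 2"
      using small[of "e / 2"] \<open>e > 0\<close> by auto
    have "nrm W (\<rho> (i m) (z m) \<ominus>\<^bsub>W\<^esub> \<rho> (i n) (z n)) < e" if "m \<ge> K" "n \<ge> K" for m n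
    proof -
      have "nrm Y (\<psi> (i m) (z m) \<ominus>\<^bsub>Y\<^esub> \<psi> (i n) (z n)) < e"
        using Y.nrm_diff_triangle[of "\<psi> (i m) (z m)" y "\<psi> (i n) (z n)"] K[OF that(1)] K[OF that(2)]
          Y.nrm_diff_swap[of y "\<psi> (i m) (z m)"] y i \<psi>_closed by simp
      then show ?thesis
        using leg_dist_eq i by simp
    qed
    then show ?thesis by blast
  qed
  obtain w where w: "w \<in> carrier W"
    and lim: "\<And>e. e > 0 \<Longrightarrow> \<exists>K. \<forall>n\<ge>K. nrm W (\<rho> (i n) (z n) \<ominus>\<^bsub>W\<^esub> w) < e"
    using W.Cauchy_convergent[of "\<lambda>n. \<rho> (i n) (z n)", OF \<rho>_closed[OF i] Cauchy] by blast
  have "corresponds y w"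
    unfolding corresponds_def
  proof (intro conjI allI impI y w)
    fix e :: real
    assume "e > 0"
    then obtain K L where K: "\<forall>n\<ge>K. nrm Y (y \<ominus>\<^bsub>Y\<^esub> \<psi> (i n) (z n)) < e"
      and L: "\<forall>n\<ge>L. nrm W (\<rho> (i n) (z n) \<ominus>\<^bsub>W\<^esub> w) < e"
      using small lim by meson
    let ?n = "max K L"
    have "nrm W (w \<ominus>\<^bsub>W\<^esub> \<rho> (i ?n) (z ?n)) < e"
      using L i w W.nrm_diff_swap[of w] \<rho>_closed by simp
    moreover have "nrm Y (y \<ominus>\<^bsub>Y\<^esub> \<psi> (i ?n) (z ?n)) < e"
      using K by simp
    ultimately show "\<exists>i\<in>I. \<exists>z\<in>carrier (Z i). nrm Y (y \<ominus>\<^bsub>Y\<^esub> \<psi> i z) < e \<and> nrm W (w \<ominus>\<^bsub>W\<^esub> \<rho> i z) < e"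
      using i by blast
  qed
  then show ?thesis ..
qed

lemma corresponds_image:
  assumes dense: "\<And>e. e > 0 \<Longrightarrow> \<exists>i\<in>I. \<exists>z\<in>carrier (Z i). nrm Y (y \<ominus>\<^bsub>Y\<^esub> \<psi> i z) < e"
    and y: "y \<in> carrier Y" and f: "linear_isometry Y W f"
    and legs: "\<And>i z. i \<in> I \<Longrightarrow> z \<in> carrier (Z i) \<Longrightarrow> f (\<psi> i z) = \<rho> i z"
  shows "corresponds y (f y)"
proof -
  have "nrm W (f y \<ominus>\<^bsub>W\<^esub> \<rho> i z) = nrm Y (y \<ominus>\<^bsub>Y\<^esub> \<psi> i z)" if "i \<in> I" "z \<in> carrier (Z i)" for i z
    using linear_isometry_dist[OF Y.normed_module_axioms W.normed_module_axioms f y, of "\<psi> i z"]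
    by (simp add: that legs \<psi>_closed)
  then have "\<exists>i\<in>I. \<exists>z\<in>carrier (Z i). nrm Y (y \<ominus>\<^bsub>Y\<^esub> \<psi> i z) < e \<and> nrm W (f y \<ominus>\<^bsub>W\<^esub> \<rho> i z) < e"
    if "e > 0" for e
    using dense[OF that] by (metis (no_types, lifting))
  moreover have "f y \<in> carrier W"
    using f y by (auto simp: linear_isometry_def)
  ultimately show ?thesis
    using y by (simp add: corresponds_def)
qed

end

text \<open>An isometry out of \<open>Y\<close> is determined by its values on a dense subset, and the values prescribed
  by the legs of \<open>W\<close> extend to \<open>Y\<close> because \<open>W\<close> is complete.\<close>

theorem colimit_if_dense_images:
  assumes "directed_set I leq" "banach_cocone I leq Z \<phi> Y \<psi>"
    and dense: "\<And>y e. y \<in> carrier Y \<Longrightarrow> e > 0 \<Longrightarrow> \<exists>i\<in>I. \<exists>z\<in>carrier (Z i). nrm Y (y \<ominus>\<^bsub>Y\<^esub> \<psi> i z) < e"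
  shows "is_banach_colimit TYPE('d) I leq Z \<phi> Y \<psi>"
  unfolding is_banach_colimit_def
proof (intro conjI allI impI assms)
  fix W :: "'d normed_space" and \<rho>
  assume "banach_cocone I leq Z \<phi> W \<rho>"
  then interpret two_cocones I leq Z \<phi> Y \<psi> W \<rho>
    using assms by (intro two_cocones.intro)
  define f where "f = (\<lambda>y\<in>carrier Y. THE w. corresponds y w)"
  have corresponds_f: "corresponds y (f y)" if y: "y \<in> carrier Y" for y
  proof -
    obtain w where w: "corresponds y w"
      using corresponds_exists[OF dense[OF y] y] by blast
    then have "(THE w. corresponds y w) = w"
      using corresponds_unique by (intro the_equality)
    then show ?thesis
      using y w by (simp add: f_def)
  qed
  have f_eq: "f y = w" if "corresponds y w" for y w
    using corresponds_unique[OF corresponds_f that] that by (simp add: corresponds_def)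
  show "\<exists>!f. f \<in> extensional (carrier Y) \<and> linear_isometry Y W f \<and>
      (\<forall>i\<in>I. \<forall>z\<in>carrier (Z i). f (\<psi> i z) = \<rho> i z)"
  proof (rule ex1I[of _ f], intro conjI)
    show "f \<in> extensional (carrier Y)"
      by (simp add: f_def)
    show "linear_isometry Y W f"
      unfolding linear_isometry_def
    proof (intro conjI ballI allI)
      show "f \<in> carrier Y \<rightarrow> carrier W"
        using corresponds_f by (auto simp: corresponds_def)
    qed (intro f_eq corresponds_add corresponds_smult corresponds_f corresponds_nrm_eq; assumption)+
    show "\<forall>i\<in>I. \<forall>z\<in>carrier (Z i). f (\<psi> i z) = \<rho> i z"
      using f_eq corresponds_legs by blast
  next
    fix g
    assume g: "g \<in> extensional (carrier Y) \<and> linear_isometry Y W g \<and>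
      (\<forall>i\<in>I. \<forall>z\<in>carrier (Z i). g (\<psi> i z) = \<rho> i z)"
    show "g = f"
    proof (rule extensionalityI)
      show "g \<in> extensional (carrier Y)" "f \<in> extensional (carrier Y)"
        using g by (simp_all add: f_def)
      show "g y = f y" if "y \<in> carrier Y" for y
        using corresponds_image[OF dense[OF that] that, of g] g f_eq by simp
    qed
  qed
qed


section \<open>Minkowski, dominated convergence and Riesz--Fischer for functions\<close>

text \<open>The norm of a class is computed from this seminorm on functions, so all of the analysis takes
  place before passing to the quotient.\<close>

definition Lp_norm :: "real \<Rightarrow> 'a measure \<Rightarrow> ('a \<Rightarrow> real) \<Rightarrow> real" where
  "Lp_norm p M u = (LINT x|M. \<bar>u x\<bar> powr p) powr (1 / p)"

lemma Lp_funD: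
  assumes "u \<in> Lp_fun p M"
  shows "u \<in> borel_measurable M" "integrable M (\<lambda>x. \<bar>u x\<bar> powr p)"
  using assms by (auto simp: Lp_fun_def)

lemma Lp_funI_bound:
  assumes "u \<in> borel_measurable M" "integrable M w" "AE x in M. \<bar>u x\<bar> powr p \<le> w x"
  shows "u \<in> Lp_fun p M"
proof -
  have "integrable M (\<lambda>x. \<bar>u x\<bar> powr p)"
    using assms by (intro Bochner_Integration.integrable_bound[OF assms(2)]) auto
  then show ?thesis
    using assms(1) by (simp add: Lp_fun_def)
qed

lemma powr_abs_add_le:
  fixes a b :: real
  assumes "p \<ge> 0"
  shows "\<bar>a + b\<bar> powr p \<le> 2 powr p * (\<bar>a\<bar> powr p + \<bar>b\<bar> powr p)"
proof -
  have "\<bar>a + b\<bar> powr p \<le> (2 * max \<bar>a\<bar> \<bar>b\<bar>) powr p"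
    using assms by (intro powr_mono2) auto
  also have "\<dots> = 2 powr p * max \<bar>a\<bar> \<bar>b\<bar> powr p"
    by (simp add: powr_mult)
  also have "\<dots> \<le> 2 powr p * (\<bar>a\<bar> powr p + \<bar>b\<bar> powr p)"
    by (intro mult_left_mono) (auto simp: max_def)
  finally show ?thesis .
qed

lemma Lp_fun_add:
  assumes "u \<in> Lp_fun p M" "v \<in> Lp_fun p M" "p \<ge> 0"
  shows "(\<lambda>x. u x + v x) \<in> Lp_fun p M"
proof (rule Lp_funI_bound)
  show "integrable M (\<lambda>x. 2 powr p * (\<bar>u x\<bar> powr p + \<bar>v x\<bar> powr p))"
    using assms by (auto dest: Lp_funD)
  show "(\<lambda>x. u x + v x) \<in> borel_measurable M"
    using assms by (auto dest: Lp_funD(1) intro: borel_measurable_add)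
qed (use assms(3) powr_abs_add_le in auto)

lemma Lp_fun_cmult: "u \<in> Lp_fun p M \<Longrightarrow> (\<lambda>x. c * u x) \<in> Lp_fun p M"
  by (auto simp: Lp_fun_def abs_mult powr_mult)

lemma Lp_fun_zero: "(\<lambda>_. 0) \<in> Lp_fun p M"
  by (simp add: Lp_fun_def)

lemma Lp_fun_diff:
  assumes "u \<in> Lp_fun p M" "v \<in> Lp_fun p M" "p \<ge> 0"
  shows "(\<lambda>x. u x - v x) \<in> Lp_fun p M"
  using Lp_fun_add[OF assms(1) Lp_fun_cmult[OF assms(2), of "- 1"] assms(3)] by simp

lemma (in finite_measure) Lp_fun_bounded:
  assumes "u \<in> borel_measurable M" "\<And>x. x \<in> space M \<Longrightarrow> \<bar>u x\<bar> \<le> B" "p \<ge> 0"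
  shows "u \<in> Lp_fun p M"
proof (rule Lp_funI_bound)
  show "AE x in M. \<bar>u x\<bar> powr p \<le> B powr p"
    using assms by (intro AE_I2 powr_mono2) auto
qed (use assms in auto)

lemma Lp_norm_nonneg: "0 \<le> Lp_norm p M u"
  by (simp add: Lp_norm_def)

lemma Lp_norm_powr:
  assumes "p > 0"
  shows "Lp_norm p M u powr p = (LINT x|M. \<bar>u x\<bar> powr p)"
  using assms by (simp add: Lp_norm_def powr_powr)

lemma Lp_norm_le_iff:
  assumes "p > 0" "e \<ge> 0"
  shows "Lp_norm p M u \<le> e \<longleftrightarrow> (LINT x|M. \<bar>u x\<bar> powr p) \<le> e powr p"
  unfolding Lp_norm_powr[OF assms(1), symmetric]
  using assms Lp_norm_nonneg[of p M u] by (smt (verit) powr_mono2 powr_less_mono2)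

lemma Lp_norm_less_iff:
  assumes "p > 0" "e \<ge> 0"
  shows "Lp_norm p M u < e \<longleftrightarrow> (LINT x|M. \<bar>u x\<bar> powr p) < e powr p"
  unfolding Lp_norm_powr[OF assms(1), symmetric]
  using assms Lp_norm_nonneg[of p M u] by (smt (verit) powr_mono2 powr_less_mono2)

lemma Lp_norm_cmult:
  assumes "p > 0"
  shows "Lp_norm p M (\<lambda>x. c * u x) = \<bar>c\<bar> * Lp_norm p M u"
  using assms by (simp add: Lp_norm_def abs_mult powr_mult powr_powr)

lemma Lp_norm_cong_AE:
  assumes "u \<in> Lp_fun p M" "v \<in> Lp_fun p M" "AE x in M. u x = v x"
  shows "Lp_norm p M u = Lp_norm p M v"
proof -
  have "(LINT x|M. \<bar>u x\<bar> powr p) = (LINT x|M. \<bar>v x\<bar> powr p)"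
    using assms by (intro integral_cong_AE) (auto dest: Lp_funD)
  then show ?thesis
    by (simp add: Lp_norm_def)
qed

lemma Lp_norm_eq_0_iff:
  assumes "u \<in> Lp_fun p M"
  shows "Lp_norm p M u = 0 \<longleftrightarrow> (AE x in M. u x = 0)"
  using integral_nonneg_eq_0_iff_AE[OF Lp_funD(2)[OF assms]] by (simp add: Lp_norm_def)

lemma powr_convex_combination:
  fixes a b s t p :: real
  assumes "p \<ge> 1" "a \<ge> 0" "b \<ge> 0" "s > 0" "t > 0" "s + t = 1"
  shows "(s * a + t * b) powr p \<le> s * a powr p + t * b powr p"
proof -
  have scale: "(r * c) powr p \<le> r * c powr p" if "0 < r" "r \<le> 1" "c \<ge> 0" for r c :: real
  proof -
    have "r powr p \<le> r powr 1"
      using that assms(1) by (intro powr_mono') auto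
    then show ?thesis
      using that by (simp add: powr_mult mult_right_mono)
  qed
  have s: "1 - t = s"
    using assms by simp
  consider "a = 0" | "b = 0" | "a > 0" "b > 0"
    using assms by linarith
  then show ?thesis
  proof cases
    case 3
    then show ?thesis
      using convex_onD[OF powr_convex[OF assms(1)], of t a b] assms s
      by simp
  qed (use assms scale in auto)
qed

text \<open>Minkowski's inequality.  For \<open>a > \<parallel>u\<parallel>\<close> and \<open>b > \<parallel>v\<parallel>\<close>, the function \<open>(u + v) / (a + b)\<close> is a
  convex combination of \<open>u / a\<close> and \<open>v / b\<close>, both in the unit ball, which is convex because
  \<open>t \<mapsto> t\<^sup>p\<close> is.\<close>

lemma Lp_norm_triangle:
  assumes p: "p \<ge> 1" and u: "u \<in> Lp_fun p M" and v: "v \<in> Lp_fun p M"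
  shows "Lp_norm p M (\<lambda>x. u x + v x) \<le> Lp_norm p M u + Lp_norm p M v"
proof (rule field_le_epsilon)
  fix e :: real
  assume "e > 0"
  define a b where "a = Lp_norm p M u + e / 2" and "b = Lp_norm p M v + e / 2"
  have ab: "a > 0" "b > 0" "Lp_norm p M u \<le> a" "Lp_norm p M v \<le> b"
    using \<open>e > 0\<close> Lp_norm_nonneg[of p M] by (auto simp: a_def b_def add_nonneg_pos)
  define s t where "s = a / (a + b)" and "t = b / (a + b)"
  have st: "s > 0" "t > 0" "s + t = 1"
    using ab by (auto simp: s_def t_def simp flip: add_divide_distrib)
  have int: "integrable M (\<lambda>x. \<bar>u x\<bar> powr p)" "integrable M (\<lambda>x. \<bar>v x\<bar> powr p)"
    "integrable M (\<lambda>x. \<bar>u x + v x\<bar> powr p)"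
    using Lp_funD(2)[OF u] Lp_funD(2)[OF v] Lp_funD(2)[OF Lp_fun_add[OF u v]] p by auto
  have pointwise: "\<bar>u x + v x\<bar> powr p \<le>
      (a + b) powr p * (s * (\<bar>u x\<bar> powr p / a powr p) + t * (\<bar>v x\<bar> powr p / b powr p))" for x
  proof -
    have "\<bar>u x + v x\<bar> powr p \<le> ((a + b) * (s * (\<bar>u x\<bar> / a) + t * (\<bar>v x\<bar> / b))) powr p"
      using ab p by (intro powr_mono2) (auto simp: s_def t_def distrib_left)
    also have "\<dots> = (a + b) powr p * (s * (\<bar>u x\<bar> / a) + t * (\<bar>v x\<bar> / b)) powr p"
      using ab st by (intro powr_mult) 
    also have "\<dots> \<le> (a + b) powr p * (s * (\<bar>u x\<bar> / a) powr p + t * (\<bar>v x\<bar> / b) powr p)"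
      using ab st p by (intro mult_left_mono powr_convex_combination) auto
    finally show ?thesis
      using ab by (simp add: powr_divide)
  qed
  have "(LINT x|M. \<bar>u x + v x\<bar> powr p) \<le>
      (LINT x|M. (a + b) powr p * (s * (\<bar>u x\<bar> powr p / a powr p) + t * (\<bar>v x\<bar> powr p / b powr p)))"
    using int pointwise by (intro integral_mono) auto
  also have "\<dots> = (a + b) powr p * (s * ((LINT x|M. \<bar>u x\<bar> powr p) / a powr p) +
      t * ((LINT x|M. \<bar>v x\<bar> powr p) / b powr p))"
    using int by simp
  also have "\<dots> \<le> (a + b) powr p * (s * 1 + t * 1)"
  proof -
    have "(LINT x|M. \<bar>u x\<bar> powr p) / a powr p \<le> 1" "(LINT x|M. \<bar>v x\<bar> powr p) / b powr p \<le> 1"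
      using ab p Lp_norm_le_iff[of p a M u] Lp_norm_le_iff[of p b M v] by auto
    then show ?thesis
      using st by (intro mult_left_mono add_mono) auto
  qed
  finally have "Lp_norm p M (\<lambda>x. u x + v x) \<le> a + b"
    using st ab p by (subst Lp_norm_le_iff) auto
  then show "Lp_norm p M (\<lambda>x. u x + v x) \<le> Lp_norm p M u + Lp_norm p M v + e"
    by (simp add: a_def b_def)
qed

lemma Lp_norm_diff_triangle:
  assumes "p \<ge> 1" "u \<in> Lp_fun p M" "v \<in> Lp_fun p M" "w \<in> Lp_fun p M"
  shows "Lp_norm p M (\<lambda>x. u x - w x) \<le> Lp_norm p M (\<lambda>x. u x - v x) + Lp_norm p M (\<lambda>x. v x - w x)"
  using Lp_norm_triangle[of p "\<lambda>x. u x - v x" M "\<lambda>x. v x - w x"] assms by (simp add: Lp_fun_diff)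

lemma Lp_norm_dominated_convergence:
  assumes p: "p \<ge> 1" and w: "w \<in> Lp_fun p M"
    and meas: "u \<in> borel_measurable M" "\<And>n. s n \<in> borel_measurable M"
    and bound: "\<And>n x. x \<in> space M \<Longrightarrow> \<bar>u x - s n x\<bar> \<le> w x"
    and lim: "\<And>x. x \<in> space M \<Longrightarrow> (\<lambda>n. s n x) \<longlonglongrightarrow> u x"
    and "e > 0"
  shows "\<exists>n. Lp_norm p M (\<lambda>x. u x - s n x) < e"
proof -
  have "(\<lambda>n. LINT x|M. \<bar>u x - s n x\<bar> powr p) \<longlonglongrightarrow> (LINT x|M. 0)"
  proof (rule integral_dominated_convergence[where w = "\<lambda>x. \<bar>w x\<bar> powr p"])
    show "AE x in M. (\<lambda>n. \<bar>u x - s n x\<bar> powr p) \<longlonglongrightarrow> 0"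
    proof (rule AE_I2)
      fix x
      assume "x \<in> space M"
      then have "(\<lambda>n. \<bar>u x - s n x\<bar>) \<longlonglongrightarrow> 0"
        using tendsto_rabs[OF tendsto_diff[OF tendsto_const lim], of x "u x"] by simp
      then show "(\<lambda>n. \<bar>u x - s n x\<bar> powr p) \<longlonglongrightarrow> 0"
        using p by (intro tendsto_zero_powrI[where b = p]) auto
    qed
    show "AE x in M. norm (\<bar>u x - s n x\<bar> powr p) \<le> \<bar>w x\<bar> powr p" for n
    proof (rule AE_I2)
      fix x
      assume "x \<in> space M"
      then have "\<bar>u x - s n x\<bar> \<le> \<bar>w x\<bar>"
        using bound[of x n] by linarith
      then show "norm (\<bar>u x - s n x\<bar> powr p) \<le> \<bar>w x\<bar> powr p"
        using p by (auto intro: powr_mono2)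
    qed
  qed (use meas Lp_funD(2)[OF w] in auto)
  then have "\<forall>\<^sub>F n in sequentially. (LINT x|M. \<bar>u x - s n x\<bar> powr p) < e powr p"
    using \<open>e > 0\<close> by (intro order_tendstoD(2)[where a = "e powr p"]) auto
  then obtain n where "(LINT x|M. \<bar>u x - s n x\<bar> powr p) < e powr p"
    using eventually_happens'[OF sequentially_bot] by blast
  then show ?thesis
    using p \<open>e > 0\<close> by (auto simp: Lp_norm_less_iff)
qed

text \<open>Where \<open>\<bar>t\<bar> > d\<close>, the factor \<open>(\<bar>t\<bar> / d)\<^bsup>p - 1\<^esup>\<close> is at least 1.\<close>

lemma abs_le_powr:
  fixes t d p :: real
  assumes "p \<ge> 1" "d > 0"
  shows "\<bar>t\<bar> \<le> d + d powr (1 - p) * \<bar>t\<bar> powr p"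
proof (cases "\<bar>t\<bar> \<le> d")
  case True
  then show ?thesis
    by (smt (verit) mult_nonneg_nonneg powr_ge_zero)
next
  case False
  then have "d powr (p - 1) * \<bar>t\<bar> \<le> \<bar>t\<bar> powr (p - 1) * \<bar>t\<bar>"
    using assms by (intro mult_right_mono powr_mono2) auto
  also have "\<dots> = \<bar>t\<bar> powr p"
    using False assms powr_add[of "\<bar>t\<bar>" "p - 1" 1] by simp
  finally have "d powr (1 - p) * (d powr (p - 1) * \<bar>t\<bar>) \<le> d powr (1 - p) * \<bar>t\<bar> powr p"
    by (intro mult_left_mono) auto
  moreover have "d powr (1 - p) * d powr (p - 1) = 1"
    using assms by (simp flip: powr_add)
  ultimately have "\<bar>t\<bar> \<le> d powr (1 - p) * \<bar>t\<bar> powr p"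
    by (simp flip: mult.assoc)
  then show ?thesis
    using assms by simp
qed

lemma (in finite_measure) Lp_fun_integrable:
  assumes "p \<ge> 1" "u \<in> Lp_fun p M"
  shows "integrable M u"
proof (rule Bochner_Integration.integrable_bound)
  show "integrable M (\<lambda>x. 1 + 1 powr (1 - p) * \<bar>u x\<bar> powr p)"
    using Lp_funD(2)[OF assms(2)] by auto
  show "AE x in M. norm (u x) \<le> norm (1 + 1 powr (1 - p) * \<bar>u x\<bar> powr p)"
    using abs_le_powr[OF assms(1), of 1] by (auto intro!: AE_I2 intro: order_trans)
qed (rule Lp_funD(1)[OF assms(2)])

text \<open>Pointwise limits inherit norm bounds, by Fatou's lemma.\<close>

lemma Lp_norm_Fatou:
  assumes p: "p \<ge> 1" and u: "\<And>n. u n \<in> Lp_fun p M" and v: "v \<in> borel_measurable M"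
    and lim: "AE x in M. (\<lambda>n. u n x) \<longlonglongrightarrow> v x"
    and bound: "\<And>n::nat. Lp_norm p M (u n) \<le> e"
  shows "v \<in> Lp_fun p M" "Lp_norm p M v \<le> e"
proof -
  have "e \<ge> 0"
    using bound[of 0] Lp_norm_nonneg[of p M "u 0"] by linarith
  have [measurable]: "u n \<in> borel_measurable M" for n
    using Lp_funD(1)[OF u] .
  have "(\<integral>\<^sup>+ x. ennreal (\<bar>v x\<bar> powr p) \<partial>M) = (\<integral>\<^sup>+ x. liminf (\<lambda>n. ennreal (\<bar>u n x\<bar> powr p)) \<partial>M)"
  proof (rule nn_integral_cong_AE)
    show "AE x in M. ennreal (\<bar>v x\<bar> powr p) = liminf (\<lambda>n. ennreal (\<bar>u n x\<bar> powr p))"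
      using lim
    proof eventually_elim
      fix x
      assume "(\<lambda>n. u n x) \<longlonglongrightarrow> v x"
      then have "(\<lambda>n. ennreal (\<bar>u n x\<bar> powr p)) \<longlonglongrightarrow> ennreal (\<bar>v x\<bar> powr p)"
        using p by (intro tendsto_ennrealI tendsto_powr' tendsto_rabs tendsto_const) auto
      then show "ennreal (\<bar>v x\<bar> powr p) = liminf (\<lambda>n. ennreal (\<bar>u n x\<bar> powr p))"
        by (rule lim_imp_Liminf[OF sequentially_bot, symmetric])
    qed
  qed
  also have "\<dots> \<le> liminf (\<lambda>n. \<integral>\<^sup>+ x. ennreal (\<bar>u n x\<bar> powr p) \<partial>M)"
    by (intro nn_integral_liminf) measurable
  also have "\<dots> \<le> liminf (\<lambda>n::nat. ennreal (e powr p))"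
  proof (intro Liminf_mono always_eventually allI)
    fix n
    have "(\<integral>\<^sup>+ x. ennreal (\<bar>u n x\<bar> powr p) \<partial>M) = ennreal (LINT x|M. \<bar>u n x\<bar> powr p)"
      using Lp_funD(2)[OF u] by (intro nn_integral_eq_integral) auto
    also have "\<dots> \<le> ennreal (e powr p)"
      using bound[of n] p \<open>e \<ge> 0\<close> by (intro ennreal_leI) (simp add: Lp_norm_le_iff)
    finally show "(\<integral>\<^sup>+ x. ennreal (\<bar>u n x\<bar> powr p) \<partial>M) \<le> ennreal (e powr p)" .
  qed
  finally have le: "(\<integral>\<^sup>+ x. ennreal (\<bar>v x\<bar> powr p) \<partial>M) \<le> ennreal (e powr p)"
    by (simp add: Liminf_const)
  have int: "integrable M (\<lambda>x. \<bar>v x\<bar> powr p)"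
  proof (rule integrableI_bounded)
    show "(\<integral>\<^sup>+ x. ennreal (norm (\<bar>v x\<bar> powr p)) \<partial>M) < \<infinity>"
      using le by (simp add: order_le_less_trans[OF le])
  qed (use v in measurable)
  then show "v \<in> Lp_fun p M"
    using v by (simp add: Lp_fun_def)
  have "ennreal (LINT x|M. \<bar>v x\<bar> powr p) \<le> ennreal (e powr p)"
    using le nn_integral_eq_integral[OF int] by simp
  then show "Lp_norm p M v \<le> e"
    using p \<open>e \<ge> 0\<close> by (simp add: Lp_norm_le_iff)
qed

text \<open>The Riesz--Fischer theorem.  On a finite measure space an \<open>L\<^sup>p\<close> Cauchy sequence is also \<open>L\<^sup>1\<close>
  Cauchy, so that a subsequence converges almost everywhere; Fatou's lemma turns this pointwise limit
  into an \<open>L\<^sup>p\<close> limit.\<close>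

lemma (in finite_measure) Lp_fun_complete:
  assumes p: "p \<ge> 1" and u: "\<And>n::nat. u n \<in> Lp_fun p M"
    and Cauchy: "\<And>e. e > 0 \<Longrightarrow> \<exists>K. \<forall>m\<ge>K. \<forall>n\<ge>K. Lp_norm p M (\<lambda>x. u m x - u n x) < e"
  shows "\<exists>v\<in>Lp_fun p M. \<forall>e>0. \<exists>K. \<forall>n\<ge>K. Lp_norm p M (\<lambda>x. u n x - v x) < e"
proof -
  have [measurable]: "u n \<in> borel_measurable M" for n
    using Lp_funD(1)[OF u] .
  have p0: "p > 0" "p \<ge> 0" using p by auto
  have diff: "(\<lambda>x. u m x - u n x) \<in> Lp_fun p M" for m n
    using u p0 by (intro Lp_fun_diff)
  have "\<exists>K. \<forall>m\<ge>K. \<forall>n\<ge>K. LINT x|M. norm (u m x - u n x) < e" if "e > 0" for e :: real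
  proof -
    define \<mu> where "\<mu> = measure M (space M)"
    define d where "d = e / (2 * (\<mu> + 1))"
    have "\<mu> \<ge> 0" by (simp add: \<mu>_def)
    then have d: "d > 0" "d * \<mu> < e / 2"
      using \<open>e > 0\<close> by (auto simp: d_def field_simps)
    \<comment> \<open>chosen such that \<open>d powr (1 - p) * c powr p = e / 2\<close>\<close>
    define c where "c = (e / 2 * d powr (p - 1)) powr (1 / p)"
    have c: "c > 0" "c powr p = e / 2 * d powr (p - 1)"
      using \<open>e > 0\<close> d p0 by (auto simp: c_def powr_powr)
    obtain K where K: "\<And>m n. m \<ge> K \<Longrightarrow> n \<ge> K \<Longrightarrow> Lp_norm p M (\<lambda>x. u m x - u n x) < c"
      using Cauchy[OF c(1)] by blast
    have "(LINT x|M. norm (u m x - u n x)) < e" if "m \<ge> K" "n \<ge> K" for m n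
    proof -
      have int: "integrable M (\<lambda>x. \<bar>u m x - u n x\<bar> powr p)"
        using Lp_funD(2)[OF diff] .
      have "(LINT x|M. norm (u m x - u n x)) \<le> (LINT x|M. d + d powr (1 - p) * \<bar>u m x - u n x\<bar> powr p)"
        using Lp_fun_integrable[OF p diff] int abs_le_powr[OF p d(1)] by (intro integral_mono) auto
      also have "\<dots> = d * \<mu> + d powr (1 - p) * (LINT x|M. \<bar>u m x - u n x\<bar> powr p)"
        using int by (simp add: \<mu>_def)
      also have "\<dots> \<le> d * \<mu> + d powr (1 - p) * (e / 2 * d powr (p - 1))"
        using K[OF that] c p0 
        by (intro add_left_mono mult_left_mono) (auto simp: Lp_norm_less_iff)
      also have "\<dots> = d * \<mu> + e / 2"
        using d(1) by (simp flip: powr_add)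
      also have "\<dots> < e"
        using d(2) by simp
      finally show ?thesis .
    qed
    then show ?thesis by blast
  qed
  then obtain r where r: "strict_mono r" and ae: "AE x in M. Cauchy (\<lambda>i. u (r i) x)"
    using cauchy_L1_AE_cauchy_subseq[of M u] Lp_fun_integrable[OF p u] by blast
  define v where "v = (\<lambda>x. lim (\<lambda>i. u (r i) x))"
  have v [measurable]: "v \<in> borel_measurable M"
    unfolding v_def by measurable
  have lim: "AE x in M. (\<lambda>i. u (r i) x) \<longlonglongrightarrow> v x"
    using ae by eventually_elim (simp add: v_def Cauchy_convergent_iff convergent_LIMSEQ_iff)
  have close: "(\<lambda>x. u n x - v x) \<in> Lp_fun p M \<and> Lp_norm p M (\<lambda>x. u n x - v x) \<le> e"
    if K: "\<forall>m\<ge>K. \<forall>n\<ge>K. Lp_norm p M (\<lambda>x. u m x - u n x) < e" and "n \<ge> K" for e K n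
  proof -
    have "AE x in M. (\<lambda>i. u n x - u (r (i + K)) x) \<longlonglongrightarrow> u n x - v x"
      using lim by eventually_elim (intro tendsto_diff tendsto_const LIMSEQ_ignore_initial_segment)
    moreover have "Lp_norm p M (\<lambda>x. u n x - u (r (i + K)) x) \<le> e" for i
    proof -
      have "r (i + K) \<ge> K"
        using seq_suble[OF r, of "i + K"] by simp
      then show ?thesis
        using K \<open>n \<ge> K\<close> by (meson less_imp_le)
    qed
    moreover have "(\<lambda>x. u n x - v x) \<in> borel_measurable M"
      by measurable
    ultimately show ?thesis
      using Lp_norm_Fatou[where u = "\<lambda>i x. u n x - u (r (i + K)) x" and v = "\<lambda>x. u n x - v x", OF p diff]
      by blast
  qed
  show ?thesis
  proof
    obtain K where "\<forall>m\<ge>K. \<forall>n\<ge>K. Lp_norm p M (\<lambda>x. u m x - u n x) < 1"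
      using Cauchy[of 1] by auto
    from close[OF this order_refl] have "(\<lambda>x. u K x - v x) \<in> Lp_fun p M" by simp
    from Lp_fun_diff[OF u[of K] this p0(2)] show "v \<in> Lp_fun p M" by simp
    show "\<forall>e>0. \<exists>K. \<forall>n\<ge>K. Lp_norm p M (\<lambda>x. u n x - v x) < e"
    proof (intro allI impI)
      fix e :: real
      assume "e > 0"
      then obtain K where "\<forall>m\<ge>K. \<forall>n\<ge>K. Lp_norm p M (\<lambda>x. u m x - u n x) < e / 2"
        using Cauchy[of "e / 2"] by auto
      from close[OF this] have "Lp_norm p M (\<lambda>x. u n x - v x) < e" if "n \<ge> K" for n
        using that \<open>e > 0\<close> by fastforce
      then show "\<exists>K. \<forall>n\<ge>K. Lp_norm p M (\<lambda>x. u n x - v x) < e" by blast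
    qed
  qed
qed


section \<open>The Banach space of classes, and pullbacks\<close>

text \<open>Defined rather than abbreviated: the simplifier rewrites membership in the image of a singleton
  to membership in the relation, and classes would lose their form.\<close>

definition Lp_class :: "real \<Rightarrow> 'a measure \<Rightarrow> ('a \<Rightarrow> real) \<Rightarrow> ('a \<Rightarrow> real) set" where
  "Lp_class p M u = Lp_rel p M `` {u}"

lemma equiv_Lp_rel: "equiv (Lp_fun p M) (Lp_rel p M)"
proof (rule equivI)
  show "refl_on (Lp_fun p M) (Lp_rel p M)"
    by (auto simp: refl_on_def Lp_rel_def)
  show "sym (Lp_rel p M)"
    by (auto simp: sym_def Lp_rel_def elim: eventually_mono)
  show "trans (Lp_rel p M)"
  proof (rule transI)
    fix u v w
    assume *: "(u, v) \<in> Lp_rel p M" "(v, w) \<in> Lp_rel p M"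
    then have "AE x in M. u x = v x" "AE x in M. v x = w x"
      by (auto simp: Lp_rel_def)
    then have "AE x in M. u x = w x"
      by eventually_elim simp
    with * show "(u, w) \<in> Lp_rel p M"
      by (auto simp: Lp_rel_def)
  qed
qed (auto simp: Lp_rel_def)

lemma carrier_Lp: "carrier (Lp p M) = Lp_class p M ` Lp_fun p M"
  by (auto simp: Lp_def quotient_def Lp_class_def)

lemma Lp_class_in_carrier: "u \<in> Lp_fun p M \<Longrightarrow> Lp_class p M u \<in> carrier (Lp p M)"
  by (simp add: carrier_Lp)

lemma carrier_LpE:
  assumes "U \<in> carrier (Lp p M)"
  obtains u where "u \<in> Lp_fun p M" "U = Lp_class p M u"
  using assms by (auto simp: carrier_Lp)

lemma Lp_class_eq_iff:
  assumes "u \<in> Lp_fun p M" "v \<in> Lp_fun p M"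
  shows "Lp_class p M u = Lp_class p M v \<longleftrightarrow> (AE x in M. u x = v x)"
  using eq_equiv_class_iff[OF equiv_Lp_rel assms] assms by (simp add: Lp_rel_def Lp_class_def)

lemma Lp_class_eqI:
  assumes "u \<in> Lp_fun p M" "v \<in> Lp_fun p M" "AE x in M. u x = v x"
  shows "Lp_class p M u = Lp_class p M v"
  using assms by (simp add: Lp_class_eq_iff)

lemma in_Lp_class_iff: "v \<in> Lp_class p M u \<longleftrightarrow> u \<in> Lp_fun p M \<and> v \<in> Lp_fun p M \<and> (AE x in M. u x = v x)"
  by (simp add: Lp_rel_def Lp_class_def)

lemma self_in_Lp_class: "u \<in> Lp_fun p M \<Longrightarrow> u \<in> Lp_class p M u"
  by (simp add: in_Lp_class_iff)

lemma add_Lp_class: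
  assumes u: "u \<in> Lp_fun p M" and v: "v \<in> Lp_fun p M" and p: "p \<ge> 0"
  shows "Lp_class p M u \<oplus>\<^bsub>Lp p M\<^esub> Lp_class p M v = Lp_class p M (\<lambda>x. u x + v x)"
proof -
  have "Lp_class p M (\<lambda>x. u' x + v' x) = Lp_class p M (\<lambda>x. u x + v x)"
    if "u' \<in> Lp_class p M u" "v' \<in> Lp_class p M v" for u' v'
  proof (rule Lp_class_eqI)
    have "AE x in M. u x = u' x" "AE x in M. v x = v' x"
      using that by (simp_all add: in_Lp_class_iff)
    then show "AE x in M. u' x + v' x = u x + v x"
      by eventually_elim simp
  qed (use that u v p in \<open>auto simp: in_Lp_class_iff intro: Lp_fun_add\<close>)
  then have "(\<Union>u'\<in>Lp_class p M u. \<Union>v'\<in>Lp_class p M v. Lp_class p M (\<lambda>x. u' x + v' x)) =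
      (\<Union>u'\<in>Lp_class p M u. \<Union>v'\<in>Lp_class p M v. Lp_class p M (\<lambda>x. u x + v x))"
    by (intro SUP_cong refl)
  also have "\<dots> = Lp_class p M (\<lambda>x. u x + v x)"
    using self_in_Lp_class[OF u] self_in_Lp_class[OF v] by blast
  finally show ?thesis
    by (simp add: Lp_def Lp_class_def)
qed

lemma smult_Lp_class:
  assumes u: "u \<in> Lp_fun p M"
  shows "c \<odot>\<^bsub>Lp p M\<^esub> Lp_class p M u = Lp_class p M (\<lambda>x. c * u x)"
proof -
  have "Lp_class p M (\<lambda>x. c * u' x) = Lp_class p M (\<lambda>x. c * u x)" if "u' \<in> Lp_class p M u" for u'
  proof (rule Lp_class_eqI)
    have "AE x in M. u x = u' x"
      using that by (simp add: in_Lp_class_iff)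
    then show "AE x in M. c * u' x = c * u x"
      by eventually_elim simp
  qed (use that u in \<open>auto simp: in_Lp_class_iff intro: Lp_fun_cmult\<close>)
  then have "(\<Union>u'\<in>Lp_class p M u. Lp_class p M (\<lambda>x. c * u' x)) =
      (\<Union>u'\<in>Lp_class p M u. Lp_class p M (\<lambda>x. c * u x))"
    by (intro SUP_cong refl)
  also have "\<dots> = Lp_class p M (\<lambda>x. c * u x)"
    using self_in_Lp_class[OF u] by blast
  finally show ?thesis
    by (simp add: Lp_def Lp_class_def)
qed

lemma zero_Lp: "\<zero>\<^bsub>Lp p M\<^esub> = Lp_class p M (\<lambda>_. 0)"
  by (simp add: Lp_def Lp_class_def)

lemma nrm_Lp_class:
  assumes u: "u \<in> Lp_fun p M"
  shows "nrm (Lp p M) (Lp_class p M u) = Lp_norm p M u"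
proof -
  have "Lp_norm p M ` Lp_class p M u = {Lp_norm p M u}"
  proof
    show "Lp_norm p M ` Lp_class p M u \<subseteq> {Lp_norm p M u}"
      by (auto simp: in_Lp_class_iff intro: Lp_norm_cong_AE[symmetric])
    show "{Lp_norm p M u} \<subseteq> Lp_norm p M ` Lp_class p M u"
      using self_in_Lp_class[OF u] by blast
  qed
  then show ?thesis
    by (simp add: Lp_def Lp_norm_def[abs_def])
qed

lemma abelian_group_Lp:
  assumes p: "p \<ge> 0"
  shows "abelian_group (Lp p M)"
proof (rule abelian_groupI)
  fix U V W
  assume "U \<in> carrier (Lp p M)" "V \<in> carrier (Lp p M)" "W \<in> carrier (Lp p M)"
  then obtain u v w where *: "u \<in> Lp_fun p M" "v \<in> Lp_fun p M" "w \<in> Lp_fun p M"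
    "U = Lp_class p M u" "V = Lp_class p M v" "W = Lp_class p M w"
    by (auto elim!: carrier_LpE)
  then show "(U \<oplus>\<^bsub>Lp p M\<^esub> V) \<oplus>\<^bsub>Lp p M\<^esub> W = U \<oplus>\<^bsub>Lp p M\<^esub> (V \<oplus>\<^bsub>Lp p M\<^esub> W)"
    using p by (simp add: add_Lp_class Lp_fun_add add.assoc)
next
  fix U V
  assume "U \<in> carrier (Lp p M)" "V \<in> carrier (Lp p M)"
  then obtain u v where *: "u \<in> Lp_fun p M" "v \<in> Lp_fun p M" "U = Lp_class p M u" "V = Lp_class p M v"
    by (auto elim!: carrier_LpE)
  then show "U \<oplus>\<^bsub>Lp p M\<^esub> V = V \<oplus>\<^bsub>Lp p M\<^esub> U" "U \<oplus>\<^bsub>Lp p M\<^esub> V \<in> carrier (Lp p M)"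
    using p by (simp_all add: add_Lp_class Lp_fun_add add.commute Lp_class_in_carrier)
next
  show "\<zero>\<^bsub>Lp p M\<^esub> \<in> carrier (Lp p M)"
    by (simp add: zero_Lp Lp_class_in_carrier Lp_fun_zero)
next
  fix U
  assume "U \<in> carrier (Lp p M)"
  then obtain u where *: "u \<in> Lp_fun p M" "U = Lp_class p M u"
    by (auto elim!: carrier_LpE)
  then show "\<zero>\<^bsub>Lp p M\<^esub> \<oplus>\<^bsub>Lp p M\<^esub> U = U"
    using p by (simp add: zero_Lp add_Lp_class Lp_fun_zero)
  have "(\<lambda>x. - u x) \<in> Lp_fun p M"
    using Lp_fun_cmult[OF *(1), of "- 1"] by simp
  with * p show "\<exists>V\<in>carrier (Lp p M). V \<oplus>\<^bsub>Lp p M\<^esub> U = \<zero>\<^bsub>Lp p M\<^esub>"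
    by (intro bexI[of _ "Lp_class p M (\<lambda>x. - u x)"])
      (simp_all add: zero_Lp add_Lp_class Lp_class_in_carrier)
qed

lemma module_Lp:
  assumes p: "p \<ge> 0"
  shows "module (ring_of_type_algebra :: real ring) (Lp p M)"
proof (rule moduleI)
  show "cring (ring_of_type_algebra :: real ring)"
    by (rule cring_from_type_algebra)
  show "abelian_group (Lp p M)"
    using p by (rule abelian_group_Lp)
next
  fix a b :: real and U
  assume "U \<in> carrier (Lp p M)"
  then obtain u where *: "u \<in> Lp_fun p M" "U = Lp_class p M u"
    by (rule carrier_LpE)
  then show "a \<odot>\<^bsub>Lp p M\<^esub> U \<in> carrier (Lp p M)"
    by (simp add: smult_Lp_class Lp_class_in_carrier Lp_fun_cmult)
  show "(a \<oplus>\<^bsub>ring_of_type_algebra\<^esub> b) \<odot>\<^bsub>Lp p M\<^esub> U = (a \<odot>\<^bsub>Lp p M\<^esub> U) \<oplus>\<^bsub>Lp p M\<^esub> (b \<odot>\<^bsub>Lp p M\<^esub> U)"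
    using * p by (simp add: add_reals smult_Lp_class add_Lp_class Lp_fun_cmult distrib_right)
  show "(a \<otimes>\<^bsub>ring_of_type_algebra\<^esub> b) \<odot>\<^bsub>Lp p M\<^esub> U = a \<odot>\<^bsub>Lp p M\<^esub> (b \<odot>\<^bsub>Lp p M\<^esub> U)"
    using * by (simp add: mult_reals smult_Lp_class Lp_fun_cmult mult.assoc)
  show "\<one>\<^bsub>(ring_of_type_algebra :: real ring)\<^esub> \<odot>\<^bsub>Lp p M\<^esub> U = U"
    using * by (simp add: one_reals smult_Lp_class)
next
  fix a :: real and U V
  assume "U \<in> carrier (Lp p M)" "V \<in> carrier (Lp p M)"
  then obtain u v where *: "u \<in> Lp_fun p M" "v \<in> Lp_fun p M" "U = Lp_class p M u" "V = Lp_class p M v"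
    by (auto elim!: carrier_LpE)
  then show "a \<odot>\<^bsub>Lp p M\<^esub> (U \<oplus>\<^bsub>Lp p M\<^esub> V) = (a \<odot>\<^bsub>Lp p M\<^esub> U) \<oplus>\<^bsub>Lp p M\<^esub> (a \<odot>\<^bsub>Lp p M\<^esub> V)"
    using p by (simp add: smult_Lp_class add_Lp_class Lp_fun_cmult Lp_fun_add distrib_left)
qed

lemma normed_module_Lp:
  assumes p: "p \<ge> 1"
  shows "normed_module (Lp p M)"
proof (rule normed_module.intro)
  show "module (ring_of_type_algebra :: real ring) (Lp p M)"
    using p by (intro module_Lp) simp
next
  fix U c
  assume "U \<in> carrier (Lp p M)"
  then obtain u where *: "u \<in> Lp_fun p M" "U = Lp_class p M u"
    by (rule carrier_LpE)
  then show "0 \<le> nrm (Lp p M) U" "nrm (Lp p M) U = 0 \<longleftrightarrow> U = \<zero>\<^bsub>Lp p M\<^esub>"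
    by (simp_all add: nrm_Lp_class Lp_norm_nonneg Lp_norm_eq_0_iff zero_Lp Lp_class_eq_iff Lp_fun_zero)
  show "nrm (Lp p M) (c \<odot>\<^bsub>Lp p M\<^esub> U) = \<bar>c\<bar> * nrm (Lp p M) U"
    using * p by (simp add: smult_Lp_class nrm_Lp_class Lp_fun_cmult Lp_norm_cmult)
next
  fix U V
  assume "U \<in> carrier (Lp p M)" "V \<in> carrier (Lp p M)"
  then obtain u v where *: "u \<in> Lp_fun p M" "v \<in> Lp_fun p M" "U = Lp_class p M u" "V = Lp_class p M v"
    by (auto elim!: carrier_LpE)
  then show "nrm (Lp p M) (U \<oplus>\<^bsub>Lp p M\<^esub> V) \<le> nrm (Lp p M) U + nrm (Lp p M) V"
    using p by (simp add: add_Lp_class nrm_Lp_class Lp_fun_add Lp_norm_triangle)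
qed

lemma diff_Lp_class:
  assumes p: "p \<ge> 1" and u: "u \<in> Lp_fun p M" and v: "v \<in> Lp_fun p M"
  shows "Lp_class p M u \<ominus>\<^bsub>Lp p M\<^esub> Lp_class p M v = Lp_class p M (\<lambda>x. u x - v x)"
proof -
  interpret normed_module "Lp p M"
    using p by (rule normed_module_Lp)
  have "\<ominus>\<^bsub>Lp p M\<^esub> Lp_class p M v = Lp_class p M (\<lambda>x. - v x)"
    using smult_minus_one[OF Lp_class_in_carrier[OF v]] v by (simp add: smult_Lp_class)
  then show ?thesis
    using u p add_Lp_class[OF u Lp_fun_cmult[OF v, of "- 1"]] by (simp add: a_minus_def)
qed

lemma (in finite_measure) banach_space_Lp:
  assumes p: "p \<ge> 1"
  shows "banach_space (Lp p M)"
proof -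
  interpret Lp: normed_module "Lp p M"
    using p by (rule normed_module_Lp)
  have dist: "nrm (Lp p M) (Lp_class p M u \<ominus>\<^bsub>Lp p M\<^esub> Lp_class p M v) = Lp_norm p M (\<lambda>x. u x - v x)"
    if "u \<in> Lp_fun p M" "v \<in> Lp_fun p M" for u v
    using p that by (simp add: diff_Lp_class nrm_Lp_class Lp_fun_diff)
  show ?thesis
    unfolding Lp.banach_space_iff_Cauchy_convergent
  proof (intro allI impI, elim conjE)
    fix s :: "nat \<Rightarrow> _"
    assume "\<forall>n. s n \<in> carrier (Lp p M)"
    then have "\<forall>n. \<exists>u. u \<in> Lp_fun p M \<and> s n = Lp_class p M u"
      by (metis carrier_LpE)
    then obtain u where u: "\<And>n. u n \<in> Lp_fun p M" and s: "\<And>n. s n = Lp_class p M (u n)"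
      by metis
    assume "\<forall>e>0. \<exists>K. \<forall>m\<ge>K. \<forall>n\<ge>K. nrm (Lp p M) (s m \<ominus>\<^bsub>Lp p M\<^esub> s n) < e"
    then have "\<exists>K. \<forall>m\<ge>K. \<forall>n\<ge>K. Lp_norm p M (\<lambda>x. u m x - u n x) < e" if "e > 0" for e
      using that by (simp add: s dist u)
    from Lp_fun_complete[OF p u this] obtain v where v: "v \<in> Lp_fun p M"
      and lim: "\<forall>e>0. \<exists>K. \<forall>n\<ge>K. Lp_norm p M (\<lambda>x. u n x - v x) < e"
      by blast
    from v lim show "\<exists>W\<in>carrier (Lp p M). \<forall>e>0. \<exists>K. \<forall>n\<ge>K. nrm (Lp p M) (s n \<ominus>\<^bsub>Lp p M\<^esub> W) < e"
      by (intro bexI[of _ "Lp_class p M v"]) (simp_all add: s dist u Lp_class_in_carrier)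
  qed
qed

text \<open>Pulling back along a measure preserving map does not change integrals, hence not the norm.\<close>

lemma Lp_fun_pullback:
  assumes "measure_preserving M N f" "u \<in> Lp_fun p N"
  shows "u \<circ> f \<in> Lp_fun p M"
proof -
  have f: "f \<in> measurable M N" "distr M N f = N"
    using assms(1) by (auto simp: measure_preserving_def)
  have "integrable (distr M N f) (\<lambda>y. \<bar>u y\<bar> powr p)"
    using Lp_funD(2)[OF assms(2)] f by simp
  then have "integrable M (\<lambda>x. \<bar>u (f x)\<bar> powr p)"
    by (rule integrable_distr[OF f(1)])
  then show ?thesis
    using measurable_comp[OF f(1) Lp_funD(1)[OF assms(2)]] by (simp add: Lp_fun_def)
qed

lemma Lp_norm_pullback:
  assumes "measure_preserving M N f" "u \<in> Lp_fun p N"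
  shows "Lp_norm p M (u \<circ> f) = Lp_norm p N u"
proof -
  have f: "f \<in> measurable M N" "distr M N f = N"
    using assms(1) by (auto simp: measure_preserving_def)
  have "(LINT y|distr M N f. \<bar>u y\<bar> powr p) = (LINT x|M. \<bar>u (f x)\<bar> powr p)"
    using Lp_funD[OF assms(2)] by (intro integral_distr[OF f(1)]) auto
  then show ?thesis
    by (simp add: Lp_norm_def f)
qed

lemma Lp_pullback_class:
  assumes f: "measure_preserving M N f" and u: "u \<in> Lp_fun p N"
  shows "Lp_pullback p M f (Lp_class p N u) = Lp_class p M (u \<circ> f)"
proof -
  have "Lp_class p M (u' \<circ> f) = Lp_class p M (u \<circ> f)" if "u' \<in> Lp_class p N u" for u'
  proof (rule Lp_class_eqI)
    have "AE y in N. u y = u' y"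
      using that by (simp add: in_Lp_class_iff)
    then have "AE y in N. u' y = u y"
      by eventually_elim simp
    then have "AE y in distr M N f. u' y = u y"
      using f by (metis measure_preserving_def)
    then show "AE x in M. (u' \<circ> f) x = (u \<circ> f) x"
      using AE_distrD[of f M N] f by (simp add: measure_preserving_def)
  qed (use that u f in \<open>auto simp: in_Lp_class_iff intro: Lp_fun_pullback\<close>)
  then have "(\<Union>u'\<in>Lp_class p N u. Lp_class p M (u' \<circ> f)) =
      (\<Union>u'\<in>Lp_class p N u. Lp_class p M (u \<circ> f))"
    by (intro SUP_cong refl)
  also have "\<dots> = Lp_class p M (u \<circ> f)"
    using self_in_Lp_class[OF u] by blast
  finally show ?thesis
    by (simp add: Lp_pullback_def Lp_class_def)
qed

lemma linear_isometry_Lp_pullback: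
  assumes f: "measure_preserving M N f" and p: "p \<ge> 0"
  shows "linear_isometry (Lp p N) (Lp p M) (Lp_pullback p M f)"
  unfolding linear_isometry_def
proof (intro conjI ballI allI)
  show "Lp_pullback p M f \<in> carrier (Lp p N) \<rightarrow> carrier (Lp p M)"
    by (auto elim!: carrier_LpE simp: Lp_pullback_class[OF f] Lp_class_in_carrier Lp_fun_pullback[OF f])
next
  fix U V
  assume "U \<in> carrier (Lp p N)" "V \<in> carrier (Lp p N)"
  then obtain u v where *: "u \<in> Lp_fun p N" "v \<in> Lp_fun p N" "U = Lp_class p N u" "V = Lp_class p N v"
    by (auto elim!: carrier_LpE)
  have "(\<lambda>x. u x + v x) \<circ> f = (\<lambda>x. (u \<circ> f) x + (v \<circ> f) x)"
    by auto
  with * p show "Lp_pullback p M f (U \<oplus>\<^bsub>Lp p N\<^esub> V) = Lp_pullback p M f U \<oplus>\<^bsub>Lp p M\<^esub> Lp_pullback p M f V"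
    by (simp only: add_Lp_class Lp_pullback_class[OF f] Lp_fun_add Lp_fun_pullback[OF f])
next
  fix c U
  assume "U \<in> carrier (Lp p N)"
  then obtain u where *: "u \<in> Lp_fun p N" "U = Lp_class p N u"
    by (rule carrier_LpE)
  have "(\<lambda>x. c * u x) \<circ> f = (\<lambda>x. c * (u \<circ> f) x)"
    by auto
  with * show "Lp_pullback p M f (c \<odot>\<^bsub>Lp p N\<^esub> U) = c \<odot>\<^bsub>Lp p M\<^esub> Lp_pullback p M f U"
    by (simp only: smult_Lp_class Lp_pullback_class[OF f] Lp_fun_cmult Lp_fun_pullback[OF f])
next
  fix U
  assume "U \<in> carrier (Lp p N)"
  then obtain u where *: "u \<in> Lp_fun p N" "U = Lp_class p N u"
    by (rule carrier_LpE)
  then show "nrm (Lp p M) (Lp_pullback p M f U) = nrm (Lp p N) U"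
    by (simp add: Lp_pullback_class[OF f] nrm_Lp_class Lp_fun_pullback[OF f] Lp_norm_pullback[OF f])
qed


section \<open>Density of the pullbacks in the limit\<close>

locale convergent_diagram = directed_set I leq + prob_diagram I leq M \<pi>
  for I :: "'i set" and leq :: "'i \<Rightarrow> 'i \<Rightarrow> bool"
    and M :: "'i \<Rightarrow> 'a measure" and \<pi> :: "'i \<Rightarrow> 'i \<Rightarrow> 'a \<Rightarrow> 'a" +
  fixes N :: "('i \<Rightarrow> 'a) measure" and p :: real
  assumes limit: "is_diagram_limit I leq M \<pi> N"
    and p: "1 \<le> p"
begin

lemma space_N: "space N = limit_space I leq M \<pi>"
  and sets_N: "sets N = limit_sets I leq M \<pi>"
  using limit by (simp_all add: is_diagram_limit_def)

lemma proj_in_space: "x \<in> space N \<Longrightarrow> i \<in> I \<Longrightarrow> x i \<in> space (M i)"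
  by (auto simp: space_N limit_space_def)

lemma proj_compatible: "x \<in> space N \<Longrightarrow> i \<in> I \<Longrightarrow> j \<in> I \<Longrightarrow> leq i j \<Longrightarrow> \<pi> i j (x j) = x i"
  by (auto simp: space_N limit_space_def)

lemma proj_measure_preserving:
  assumes "i \<in> I"
  shows "measure_preserving N (M i) (\<lambda>x. x i)"
  unfolding measure_preserving_def
proof
  show "(\<lambda>x. x i) \<in> measurable N (M i)"
  proof (rule measurableI)
    fix B
    assume "B \<in> sets (M i)"
    then show "(\<lambda>x. x i) -` B \<inter> space N \<in> sets N"
      using assms unfolding sets_N limit_sets_def space_N by (intro sigma_sets.Basic) blast
  qed (use assms proj_in_space in blast)
  show "distr N (M i) (\<lambda>x. x i) = M i"
    using limit assms by (simp add: is_diagram_limit_def)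
qed

lemma prob_space_N: "prob_space N"
proof -
  obtain i where i: "i \<in> I"
    using nonempty by blast
  show ?thesis
    using prob_space_distrD[of "\<lambda>x. x i" N "M i"] proj_measure_preserving[OF i] prob[OF i]
    by (simp add: measure_preserving_def)
qed

sublocale N: prob_space N
  by (rule prob_space_N)

lemma Lp_fun_proj: "i \<in> I \<Longrightarrow> v \<in> Lp_fun p (M i) \<Longrightarrow> (\<lambda>x. v (x i)) \<in> Lp_fun p N"
  using Lp_fun_pullback[OF proj_measure_preserving, of i v p] by (simp add: comp_def)

text \<open>Membership in the closure of the functions that depend on a single coordinate.\<close>

definition approximable :: "(('i \<Rightarrow> 'a) \<Rightarrow> real) \<Rightarrow> bool" where
  "approximable u \<longleftrightarrow> u \<in> Lp_fun p N \<and>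
    (\<forall>e>0. \<exists>i\<in>I. \<exists>v\<in>Lp_fun p (M i). Lp_norm p N (\<lambda>x. u x - v (x i)) < e)"

lemma approximable_Lp_fun: "approximable u \<Longrightarrow> u \<in> Lp_fun p N"
  by (simp add: approximable_def)

lemma approximableE:
  assumes "approximable u" "e > 0"
  obtains i v where "i \<in> I" "v \<in> Lp_fun p (M i)" "Lp_norm p N (\<lambda>x. u x - v (x i)) < e"
  using assms unfolding approximable_def by blast

lemma approximable_proj:
  assumes "i \<in> I" "v \<in> Lp_fun p (M i)"
  shows "approximable (\<lambda>x. v (x i))"
proof -
  have "Lp_norm p N (\<lambda>x. v (x i) - v (x i)) = 0"
    by (simp add: Lp_norm_def)
  then show ?thesis
    using assms by (auto simp: approximable_def Lp_fun_proj intro!: bexI[of _ i] bexI[of _ v])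
qed

text \<open>Approximations over \<open>X\<^sub>i\<close> and \<open>X\<^sub>j\<close> are added after pulling both back to a common \<open>X\<^sub>k\<close>.\<close>

lemma approximable_add:
  assumes "approximable u" "approximable u'"
  shows "approximable (\<lambda>x. u x + u' x)"
  unfolding approximable_def
proof (intro conjI allI impI)
  have uL: "u \<in> Lp_fun p N" "u' \<in> Lp_fun p N"
    using assms by (simp_all add: approximable_Lp_fun)
  then show "(\<lambda>x. u x + u' x) \<in> Lp_fun p N"
    using p by (simp add: Lp_fun_add)
  fix e :: real
  assume "e > 0"
  then have e2: "e / 2 > 0" by simp
  obtain i v where i: "i \<in> I" "v \<in> Lp_fun p (M i)" "Lp_norm p N (\<lambda>x. u x - v (x i)) < e / 2"
    using approximableE[OF assms(1) e2] .
  obtain j v' where j: "j \<in> I" "v' \<in> Lp_fun p (M j)" "Lp_norm p N (\<lambda>x. u' x - v' (x j)) < e / 2"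
    using approximableE[OF assms(2) e2] .
  obtain k where k: "k \<in> I" "leq i k" "leq j k"
    using upper_bound i j by blast
  define w where "w = (\<lambda>y. (v \<circ> \<pi> i k) y + (v' \<circ> \<pi> j k) y)"
  have "w \<in> Lp_fun p (M k)"
    unfolding w_def
    using Lp_fun_pullback[OF preserving[OF i(1) k(1,2)] i(2)]
      Lp_fun_pullback[OF preserving[OF j(1) k(1,3)] j(2)] p
    by (simp add: Lp_fun_add del: o_apply)
  moreover have "Lp_norm p N (\<lambda>x. u x + u' x - w (x k)) < e"
  proof -
    have "Lp_norm p N (\<lambda>x. u x + u' x - w (x k)) =
        Lp_norm p N (\<lambda>x. (u x - v (x i)) + (u' x - v' (x j)))"
      unfolding Lp_norm_def using i j k
      by (intro arg_cong[where f = "\<lambda>t. t powr (1 / p)"] Bochner_Integration.integral_cong refl)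
        (simp add: w_def proj_compatible algebra_simps)
    also have "\<dots> \<le> Lp_norm p N (\<lambda>x. u x - v (x i)) + Lp_norm p N (\<lambda>x. u' x - v' (x j))"
      using p uL i j by (intro Lp_norm_triangle Lp_fun_diff Lp_fun_proj) auto
    finally show ?thesis
      using i j by simp
  qed
  ultimately show "\<exists>i\<in>I. \<exists>w\<in>Lp_fun p (M i). Lp_norm p N (\<lambda>x. u x + u' x - w (x i)) < e"
    using k by blast
qed

lemma approximable_cmult:
  assumes "approximable u"
  shows "approximable (\<lambda>x. c * u x)"
  unfolding approximable_def
proof (intro conjI allI impI)
  show "(\<lambda>x. c * u x) \<in> Lp_fun p N"
    using assms by (intro Lp_fun_cmult approximable_Lp_fun)
  fix e :: real
  assume "e > 0"
  \<comment> \<open>adding 1 keeps the denominator positive when \<open>c = 0\<close>\<close>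
  define d where "d = e / (\<bar>c\<bar> + 1)"
  have d: "d > 0" "\<bar>c\<bar> * d < e"
    using \<open>e > 0\<close> by (simp_all add: d_def field_simps)
  obtain i v where i: "i \<in> I" "v \<in> Lp_fun p (M i)" "Lp_norm p N (\<lambda>x. u x - v (x i)) < d"
    using approximableE[OF assms d(1)] .
  have "Lp_norm p N (\<lambda>x. c * u x - c * v (x i)) = \<bar>c\<bar> * Lp_norm p N (\<lambda>x. u x - v (x i))"
    using p Lp_norm_cmult[of p N c "\<lambda>x. u x - v (x i)"] by (simp add: right_diff_distrib)
  also have "\<dots> \<le> \<bar>c\<bar> * d"
    using i by (intro mult_left_mono) auto
  finally have "Lp_norm p N (\<lambda>x. c * u x - c * v (x i)) < e"
    using d by simp
  then show "\<exists>i\<in>I. \<exists>w\<in>Lp_fun p (M i). Lp_norm p N (\<lambda>x. c * u x - w (x i)) < e"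
    using i Lp_fun_cmult[OF i(2), of c] by (intro bexI[of _ i] bexI[of _ "\<lambda>y. c * v y"])
qed

lemma approximable_sum:
  assumes "finite K" "\<And>k. k \<in> K \<Longrightarrow> approximable (f k)"
  shows "approximable (\<lambda>x. \<Sum>k\<in>K. f k x)"
  using assms
proof (induction K)
  case empty
  obtain i where "i \<in> I"
    using nonempty by blast
  then show ?case
    using approximable_proj[OF _ Lp_fun_zero] by simp
next
  case (insert k K)
  then show ?case
    by (simp add: approximable_add)
qed

lemma approximable_closed:
  assumes u: "u \<in> Lp_fun p N"
    and close: "\<And>e. e > 0 \<Longrightarrow> \<exists>u'. approximable u' \<and> Lp_norm p N (\<lambda>x. u x - u' x) < e"
  shows "approximable u"
  unfolding approximable_def
proof (intro conjI allI impI u)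
  fix e :: real
  assume "e > 0"
  then have e2: "e / 2 > 0" by simp
  obtain u' where u': "approximable u'" "Lp_norm p N (\<lambda>x. u x - u' x) < e / 2"
    using close[OF e2] by blast
  obtain i v where i: "i \<in> I" "v \<in> Lp_fun p (M i)" "Lp_norm p N (\<lambda>x. u' x - v (x i)) < e / 2"
    using approximableE[OF u'(1) e2] .
  have "Lp_norm p N (\<lambda>x. u x - v (x i)) < e"
    using Lp_norm_diff_triangle[OF p u approximable_Lp_fun[OF u'(1)] Lp_fun_proj[OF i(1,2)]] u' i
    by simp
  then show "\<exists>i\<in>I. \<exists>v\<in>Lp_fun p (M i). Lp_norm p N (\<lambda>x. u x - v (x i)) < e"
    using i by blast
qed

text \<open>Two cylinder sets over \<open>X\<^sub>i\<close> and \<open>X\<^sub>j\<close> are both cylinder sets over any \<open>X\<^sub>k\<close> with \<open>k\<close> above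
  \<open>i\<close> and \<open>j\<close>.  This is where directedness makes the generators of the limit \<open>\<sigma>\<close>-algebra a
  \<open>\<pi>\<close>-system.\<close>

lemma Int_stable_cylinders:
  "Int_stable {(\<lambda>x. x i) -` B \<inter> space N | i B. i \<in> I \<and> B \<in> sets (M i)}"
proof (rule Int_stableI)
  fix A A'
  assume "A \<in> {(\<lambda>x. x i) -` B \<inter> space N | i B. i \<in> I \<and> B \<in> sets (M i)}"
    and "A' \<in> {(\<lambda>x. x i) -` B \<inter> space N | i B. i \<in> I \<and> B \<in> sets (M i)}"
  then obtain i B j B' where i: "i \<in> I" "B \<in> sets (M i)" "A = (\<lambda>x. x i) -` B \<inter> space N"
    and j: "j \<in> I" "B' \<in> sets (M j)" "A' = (\<lambda>x. x j) -` B' \<inter> space N"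
    by blast
  obtain k where k: "k \<in> I" "leq i k" "leq j k"
    using upper_bound i j by blast
  define C where "C = (\<pi> i k -` B \<inter> space (M k)) \<inter> (\<pi> j k -` B' \<inter> space (M k))"
  have "\<pi> i k \<in> measurable (M k) (M i)" "\<pi> j k \<in> measurable (M k) (M j)"
    using preserving i j k by (auto simp: measure_preserving_def)
  then have "C \<in> sets (M k)"
    unfolding C_def using i j by (intro sets.Int measurable_sets)
  moreover have "A \<inter> A' = (\<lambda>x. x k) -` C \<inter> space N"
    using i j k by (auto simp: C_def proj_compatible proj_in_space)
  ultimately show "A \<inter> A' \<in> {(\<lambda>x. x i) -` B \<inter> space N | i B. i \<in> I \<and> B \<in> sets (M i)}"
    using k by blast
qed

text \<open>Indicators of cylinder sets depend on one coordinate.  Complements and countable disjoint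
  unions of sets amount to differences and dominated limits of their indicators, which stay in the
  closure, so the cylinder sets being a \<open>\<pi>\<close>-system suffices to reach the whole \<open>\<sigma>\<close>-algebra.\<close>

lemma approximable_indicator:
  assumes "A \<in> sets N"
  shows "approximable (indicator A)"
proof -
  let ?G = "{(\<lambda>x. x i) -` B \<inter> space N | i B. i \<in> I \<and> B \<in> sets (M i)}"
  have sigma: "sets N = sigma_sets (space N) ?G"
    by (simp add: sets_N limit_sets_def space_N)
  have bounded: "indicator A \<in> Lp_fun p N" if "A \<in> sets N" for A
    using that p by (intro N.Lp_fun_bounded[where B = 1]) (auto simp: indicator_def)
  have "?G \<subseteq> Pow (space N)"
    by auto
  from Int_stable_cylinders this assms[unfolded sigma] show ?thesis
  proof (induction rule: sigma_sets_induct_disjoint)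
    case (basic A)
    then obtain i B where i: "i \<in> I" and B: "B \<in> sets (M i)" "A = (\<lambda>x. x i) -` B \<inter> space N"
      by blast
    have A: "A \<in> sets N"
      unfolding sigma using basic by (rule sigma_sets.Basic)
    interpret Mi: prob_space "M i"
      by (rule prob) fact
    have Lp_B: "indicator B \<in> Lp_fun p (M i)"
      using B p by (intro Mi.Lp_fun_bounded[where B = 1]) (auto simp: indicator_def)
    have "Lp_norm p N (\<lambda>x. indicator A x - indicator B (x i)) = Lp_norm p N (\<lambda>_. 0)"
      unfolding Lp_norm_def
      by (intro arg_cong[where f = "\<lambda>t. t powr (1 / p)"] Bochner_Integration.integral_cong refl)
        (auto simp: B indicator_def)
    then have "Lp_norm p N (\<lambda>x. indicator A x - indicator B (x i)) = 0"
      by (simp add: Lp_norm_def)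
    with approximable_proj[OF i Lp_B] show ?case
      by (intro approximable_closed bounded A exI[of _ "\<lambda>x. indicator B (x i)"]) auto
  next
    case empty
    show ?case
      using approximable_sum[of "{}"] by (simp add: indicator_def)
  next
    case (compl A)
    have A: "A \<in> sets N"
      unfolding sigma by (rule compl(1))
    obtain i where i: "i \<in> I"
      using nonempty by blast
    interpret Mi: prob_space "M i"
      by (rule prob) fact
    have "(\<lambda>_. 1) \<in> Lp_fun p (M i)"
      using p by (intro Mi.Lp_fun_bounded[where B = 1]) auto
    from approximable_add[OF approximable_proj[OF i this] approximable_cmult[OF compl(2), of "- 1"]]
    have approx: "approximable (\<lambda>x. 1 - indicator A x)"
      by simp
    have "Lp_norm p N (\<lambda>x. indicator (space N - A) x - (1 - indicator A x)) = Lp_norm p N (\<lambda>_. 0)"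
      unfolding Lp_norm_def
      by (intro arg_cong[where f = "\<lambda>t. t powr (1 / p)"] Bochner_Integration.integral_cong refl)
        (auto simp: indicator_def)
    then have "Lp_norm p N (\<lambda>x. indicator (space N - A) x - (1 - indicator A x)) = 0"
      by (simp add: Lp_norm_def)
    with approx A show ?case
      by (intro approximable_closed bounded exI[of _ "\<lambda>x. 1 - indicator A x"]) auto
  next
    case (union A)
    have A: "A n \<in> sets N" for n
      unfolding sigma using union(2) by blast
    define s where "s = (\<lambda>n x. \<Sum>k<n. indicator (A k) x :: real)"
    have s: "approximable (s n)" for n
      unfolding s_def using union(3) by (intro approximable_sum) auto
    have s_eq: "s n x = indicator (\<Union>k<n. A k) x" for n x
      unfolding s_def using union(1)
      by (intro indicator_UN_disjoint[symmetric]) (auto intro: disjoint_family_on_mono)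
    have lim: "(\<lambda>n. s n x) \<longlonglongrightarrow> indicator (\<Union>k. A k) x" for x
      unfolding s_eq by (rule LIMSEQ_indicator_UN)
    show ?case
    proof (rule approximable_closed)
      show "indicator (\<Union>k. A k) \<in> Lp_fun p N"
        using A by (intro bounded) auto
      fix e :: real
      assume "e > 0"
      have "\<exists>n. Lp_norm p N (\<lambda>x. indicator (\<Union>k. A k) x - s n x) < e"
      proof (rule Lp_norm_dominated_convergence[OF p])
        show "(\<lambda>_. 1) \<in> Lp_fun p N"
          using p by (intro N.Lp_fun_bounded[where B = 1]) auto
        show "\<bar>indicator (\<Union>k. A k) x - s n x\<bar> \<le> 1" for n x
          by (auto simp: s_eq indicator_def)
      qed (use A lim \<open>e > 0\<close> s[THEN approximable_Lp_fun] in \<open>auto dest: Lp_funD\<close>)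
      then show "\<exists>u'. approximable u' \<and> Lp_norm p N (\<lambda>x. indicator (\<Union>k. A k) x - u' x) < e"
        using s by blast
    qed
  qed
qed

text \<open>Simple functions are combinations of indicators, and every \<open>L\<^sup>p\<close> function is a dominated
  limit of simple functions.\<close>

theorem approximable_Lp:
  assumes u: "u \<in> Lp_fun p N"
  shows "approximable u"
proof -
  obtain F where F: "\<And>n. simple_function N (F n)" "\<And>x. x \<in> space N \<Longrightarrow> (\<lambda>n. F n x) \<longlonglongrightarrow> u x"
    and bound: "\<And>n x. x \<in> space N \<Longrightarrow> \<bar>F n x\<bar> \<le> 2 * \<bar>u x\<bar>"
    using borel_measurable_implies_sequence_metric[OF Lp_funD(1)[OF u], of 0] unfolding dist_norm diff_0_right real_norm_def
    by blast
  \<comment> \<open>\<open>F n\<close> may take further values outside \<open>space N\<close>; \<open>s n\<close> vanishes there\<close>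
  define s where "s = (\<lambda>n x. \<Sum>y\<in>F n ` space N. y * indicator (F n -` {y} \<inter> space N) x)"
  have s: "approximable (s n)" for n
    unfolding s_def using F(1)[of n]
    by (intro approximable_sum approximable_cmult approximable_indicator) (auto dest: simple_functionD)
  have s_eq: "s n x = F n x" if "x \<in> space N" for n x
  proof -
    have "s n x = (\<Sum>y\<in>F n ` space N. if y = F n x then y else 0)"
      unfolding s_def using that by (intro sum.cong) auto
    then show ?thesis
      using that simple_functionD(1)[OF F(1)[of n]] by simp
  qed
  show ?thesis
  proof (rule approximable_closed[OF u])
    fix e :: real
    assume "e > 0"
    have "\<exists>n. Lp_norm p N (\<lambda>x. u x - s n x) < e"
    proof (rule Lp_norm_dominated_convergence[OF p])
      \<comment> \<open>\<open>\<bar>F n x\<bar> \<le> 2 * \<bar>u x\<bar>\<close>, hence the factor 3\<close>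
      have "(\<lambda>x. \<bar>u x\<bar>) \<in> Lp_fun p N"
        using u by (auto simp: Lp_fun_def)
      then show "(\<lambda>x. 3 * \<bar>u x\<bar>) \<in> Lp_fun p N"
        by (rule Lp_fun_cmult)
      show "\<bar>u x - s n x\<bar> \<le> 3 * \<bar>u x\<bar>" if "x \<in> space N" for n x
        using bound[OF that, of n] by (simp add: s_eq[OF that])
      show "(\<lambda>n. s n x) \<longlonglongrightarrow> u x" if "x \<in> space N" for x
        using F(2)[OF that] by (simp add: s_eq[OF that])
    qed (use u \<open>e > 0\<close> s[THEN approximable_Lp_fun] in \<open>auto dest: Lp_funD\<close>)
    then show "\<exists>u'. approximable u' \<and> Lp_norm p N (\<lambda>x. u x - u' x) < e"
      using s by blast
  qed
qed

lemma dense_pullbacks: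
  assumes U: "U \<in> carrier (Lp p N)" and "e > 0"
  shows "\<exists>i\<in>I. \<exists>V\<in>carrier (Lp p (M i)).
    nrm (Lp p N) (U \<ominus>\<^bsub>Lp p N\<^esub> Lp_pullback p N (\<lambda>x. x i) V) < e"
proof -
  obtain u where u: "u \<in> Lp_fun p N" "U = Lp_class p N u"
    using U by (rule carrier_LpE)
  obtain i v where i: "i \<in> I" "v \<in> Lp_fun p (M i)" "Lp_norm p N (\<lambda>x. u x - v (x i)) < e"
    using approximableE[OF approximable_Lp[OF u(1)] \<open>e > 0\<close>] .
  have "nrm (Lp p N) (U \<ominus>\<^bsub>Lp p N\<^esub> Lp_pullback p N (\<lambda>x. x i) (Lp_class p (M i) v)) < e"
    using i u p Lp_fun_proj[OF i(1,2)]
    by (simp add: Lp_pullback_class[OF proj_measure_preserving] comp_def diff_Lp_class nrm_Lp_class Lp_fun_diff)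
  then show ?thesis
    using i Lp_class_in_carrier by blast
qed

lemma banach_cocone_Lp:
  "banach_cocone I leq (\<lambda>i. Lp p (M i)) (\<lambda>i j. Lp_pullback p (M j) (\<pi> i j))
    (Lp p N) (\<lambda>i. Lp_pullback p N (\<lambda>x. x i))"
proof (intro banach_cocone.intro banach_codiagram.intro banach_cocone_axioms.intro)
  fix i
  assume i: "i \<in> I"
  interpret Mi: prob_space "M i"
    by (rule prob) fact
  show "banach_space (Lp p (M i))"
    using p by (rule Mi.banach_space_Lp)
  show "linear_isometry (Lp p (M i)) (Lp p N) (Lp_pullback p N (\<lambda>x. x i))"
    using i p by (intro linear_isometry_Lp_pullback proj_measure_preserving) auto
next
  fix i j
  assume "i \<in> I" "j \<in> I" "leq i j"
  then show "linear_isometry (Lp p (M i)) (Lp p (M j)) (Lp_pullback p (M j) (\<pi> i j))"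
    using p by (intro linear_isometry_Lp_pullback preserving) auto
next
  show "banach_space (Lp p N)"
    using p by (rule N.banach_space_Lp)
next
  fix i z
  assume i: "i \<in> I" and "z \<in> carrier (Lp p (M i))"
  then obtain v where v: "v \<in> Lp_fun p (M i)" "z = Lp_class p (M i) v"
    using carrier_LpE by blast
  have pres: "measure_preserving (M i) (M i) (\<pi> i i)"
    using i leq_refl by (intro preserving) (auto simp: reflp_on_def)
  have "Lp_class p (M i) (v \<circ> \<pi> i i) = Lp_class p (M i) v"
    using i v pres by (intro Lp_class_eqI Lp_fun_pullback[OF pres] AE_I2) (simp_all add: ident)
  then show "Lp_pullback p (M i) (\<pi> i i) z = z"
    using v by (simp add: Lp_pullback_class[OF pres])
next
  fix i j k z
  assume ijk: "i \<in> I" "j \<in> I" "k \<in> I" "leq i j" "leq j k" and "z \<in> carrier (Lp p (M i))"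
  then obtain v where v: "v \<in> Lp_fun p (M i)" "z = Lp_class p (M i) v"
    using carrier_LpE by blast
  have "leq i k"
    using ijk leq_trans by (meson transp_onD)
  then have pres: "measure_preserving (M j) (M i) (\<pi> i j)" "measure_preserving (M k) (M j) (\<pi> j k)"
    "measure_preserving (M k) (M i) (\<pi> i k)"
    using ijk preserving by auto
  note Lp = Lp_fun_pullback[OF pres(1) v(1)] Lp_fun_pullback[OF pres(3) v(1)]
  have "Lp_class p (M k) (v \<circ> \<pi> i k) = Lp_class p (M k) (v \<circ> \<pi> i j \<circ> \<pi> j k)"
    using ijk by (intro Lp_class_eqI Lp Lp_fun_pullback[OF pres(2)] AE_I2) (simp add: compose)
  then show "Lp_pullback p (M k) (\<pi> i k) z = Lp_pullback p (M k) (\<pi> j k) (Lp_pullback p (M j) (\<pi> i j) z)"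
    using v Lp by (simp add: Lp_pullback_class pres)
next
  fix i j z
  assume ij: "i \<in> I" "j \<in> I" "leq i j" and "z \<in> carrier (Lp p (M i))"
  then obtain v where v: "v \<in> Lp_fun p (M i)" "z = Lp_class p (M i) v"
    using carrier_LpE by blast
  have pres: "measure_preserving (M j) (M i) (\<pi> i j)" "measure_preserving N (M i) (\<lambda>x. x i)"
    "measure_preserving N (M j) (\<lambda>x. x j)"
    using ij preserving proj_measure_preserving by auto
  note Lp = Lp_fun_pullback[OF pres(1) v(1)] Lp_fun_pullback[OF pres(2) v(1)]
  have "Lp_class p N (v \<circ> (\<lambda>x. x i)) = Lp_class p N (v \<circ> \<pi> i j \<circ> (\<lambda>x. x j))"
    using ij by (intro Lp_class_eqI Lp Lp_fun_pullback[OF pres(3)] AE_I2) (simp add: proj_compatible)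
  then show "Lp_pullback p N (\<lambda>x. x i) z = Lp_pullback p N (\<lambda>x. x j) (Lp_pullback p (M j) (\<pi> i j) z)"
    using v Lp by (simp add: Lp_pullback_class pres)
qed

end


section \<open>The functor \<open>L\<^sup>p\<close> sends limits to colimits\<close>

theorem theorem3p1:
  fixes I :: "'i set" and leq :: "'i \<Rightarrow> 'i \<Rightarrow> bool"
    and M :: "'i \<Rightarrow> 'a measure" and \<pi> :: "'i \<Rightarrow> 'i \<Rightarrow> 'a \<Rightarrow> 'a"
    and N :: "('i \<Rightarrow> 'a) measure" and p :: real
  assumes "directed_set I leq"
    and "prob_diagram I leq M \<pi>"
    and "is_diagram_limit I leq M \<pi> N"
    and "1 \<le> p"
  shows "is_banach_colimit TYPE('d) I leq
    (\<lambda>i. Lp p (M i)) (\<lambda>i j. Lp_pullback p (M j) (\<pi> i j))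
    (Lp p N) (\<lambda>i. Lp_pullback p N (\<lambda>x. x i))"
proof -
  interpret convergent_diagram I leq M \<pi> N p
    using assms by (intro convergent_diagram.intro convergent_diagram_axioms.intro)
  show ?thesis
    using assms(1) banach_cocone_Lp dense_pullbacks by (rule colimit_if_dense_images)
qed

end
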